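(* Let $\phi:K\to L$ be a continuous increasing surjection between compact lines $K$ and $L$. Let $T:C(L)\to c_0$ be a bounded operator associated with a weak*-null sequence $(F_n)_{n\ge1}$ in $\mathrm{NBV}(L)$. The following conditions are equivalent: (a) there exists a bounded operator $T':C(K)\to c_0$ with $T'\circ\phi^*=T$; (b) the set of points $t\in Q(\phi)$ such that $(F_n(t))_{n\ge1}$ does not converge to $0$ is countable; (c) the set of points $t\in Q_0(\phi)$ such that $(F_n(t))_{n\ge1}$ does not converge to $0$ is countable; (d) there exists a bounded operator $T':C(K)\to c_0$ with $T'\circ\phi^*=T$ and $\Vert T'\Vert\le2\Vert T\Vert$.
   Context: A compact line is a linearly ordered set which is compact in its order topology; its minimum is denoted by $0$. "Increasing" means order-preserving in the weak sense. "Countable" means finite or countably infinite. $C(K)$ is the Banach space of continuous real-valued functions on $K$ with the supremum norm, and $\phi^*:C(L)\to C(K)$ is $\phi^*(f)=f\circ\phi$. $M(L)$ is the space of finite countably additive signed regular Borel measures on $L$ with the total variation norm, identified with the dual of $C(L)$. $\mathrm{NBV}(L)$ is the space of right-continuous functions $F:L\to\mathbb{R}$ of bounded variation, i.e. with $V(F)=\sup\sum_i|F(t_{i+1})-F(t_i)|<\infty$ (supremum over finite increasing sequences in $L$), with norm $\Vert F\Vert_{\mathrm{BV}}=|F(0)|+V(F)$. The map $\mu\mapsto F_\mu$, $F_\mu(t)=\mu([0,t])$, is a linear isometry from $M(L)$ onto $\mathrm{NBV}(L)$, and elements of $\mathrm{NBV}(L)$ are identified with measures through it; a sequence in $\mathrm{NBV}(L)$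 is weak*-null if the corresponding sequence of measures is weak*-null in $M(L)=C(L)^*$. The operator $T$ is associated with $(F_n)_{n\ge1}$ if $T(f)=\big(\int_L f\,\mathrm{d}\mu_n\big)_{n\ge1}$ for all $f\in C(L)$, where $\mu_n\in M(L)$ is the measure with $F_{\mu_n}=F_n$. A point $x$ of a linearly ordered set $X$ is internal if it is neither the minimum nor the maximum of $X$, for every $y\in X$ with $y>x$ the interval $]x,y[$ is nonempty, and for every $y\in X$ with $y<x$ the interval $]y,x[$ is nonempty. Define $Q(\phi)=\{t\in L: |\phi^{-1}(t)|>1\}$ and $Q_0(\phi)=\{t\in Q(\phi): t \text{ is an internal point of } L\}$. *)

theory Defs
  imports "HOL-Analysis.Analysis"
begin

text \<open>
  A compact line is a type of class \<open>linorder_topology\<close> (its topology is the order topology) whose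
  universe is compact. On such a type every continuous real-valued function is bounded, so the
  library type \<open>'a \<Rightarrow>\<^sub>C real\<close> with its supremum norm is the Banach space $C(K)$.
\<close>

subsection \<open>Pullback operators and the space of null sequences\<close>

definition pullback :: "('k::topological_space \<Rightarrow> 'l::topological_space) \<Rightarrow> ('l \<Rightarrow>\<^sub>C real) \<Rightarrow> ('k \<Rightarrow>\<^sub>C real)"
  where "pullback \<phi> f = Bcontfun (\<lambda>x. f (\<phi> x))"

lemma apply_pullback:
  assumes "continuous_on UNIV \<phi>"
  shows "apply_bcontfun (pullback \<phi> f) x = f (\<phi> x)"
proof -
  have "continuous_on UNIV (\<lambda>x. f (\<phi> x))"
    by (rule continuous_on_compose2[OF continuous_on_apply_bcontfun assms]) auto
  moreover have "bounded (range (\<lambda>x. f (\<phi> x)))"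
    by (rule bounded_subset[OF bounded_apply_bcontfun[of f]]) auto
  ultimately show ?thesis
    unfolding pullback_def by (subst Bcontfun_inverse) (auto simp: bcontfun_def)
qed

text \<open>
  Since \<open>nat\<close> is discrete, \<open>nat \<Rightarrow>\<^sub>C real\<close> is the Banach space of all bounded sequences with the
  supremum norm; $c_0$ is the following closed subspace of it.
\<close>

definition c0 :: "(nat \<Rightarrow>\<^sub>C real) set"
  where "c0 = {x. apply_bcontfun x \<longlonglongrightarrow> 0}"

subsection \<open>Regular signed Borel measures\<close>

definition signed_borel_measure :: "('a::topological_space set \<Rightarrow> real) \<Rightarrow> bool"
  where "signed_borel_measure \<mu> \<longleftrightarrow>
    (\<forall>A::nat \<Rightarrow> 'a set. range A \<subseteq> sets borel \<longrightarrow> disjoint_family A \<longrightarrow>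
      (\<lambda>n. \<mu> (A n)) sums \<mu> (\<Union>n. A n))"

text \<open>
  The positive part of the Jordan decomposition,
  $\mu^+(A) = \sup \{\mu(B) : B \subseteq A \mbox{ Borel}\}$. The supremum is nonnegative because of
  $B = \emptyset$, so it does no harm that \<open>ennreal\<close> truncates negative values to 0.
  For a signed Borel measure the set function is countably additive, so that \<open>measure_of\<close>
  yields a measure with these values.
\<close>

definition pos_part :: "('a::topological_space set \<Rightarrow> real) \<Rightarrow> 'a measure"
  where "pos_part \<mu> =
    measure_of UNIV (sets borel) (\<lambda>A. SUP B\<in>{B \<in> sets borel. B \<subseteq> A}. ennreal (\<mu> B))"

definition neg_part :: "('a::topological_space set \<Rightarrow> real) \<Rightarrow> 'a measure"
  where "neg_part \<mu> = pos_part (\<lambda>A. - \<mu> A)"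

definition total_variation :: "('a::topological_space set \<Rightarrow> real) \<Rightarrow> 'a set \<Rightarrow> ennreal"
  where "total_variation \<mu> A = emeasure (pos_part \<mu>) A + emeasure (neg_part \<mu>) A"

definition signed_integral :: "('a::topological_space set \<Rightarrow> real) \<Rightarrow> ('a \<Rightarrow> real) \<Rightarrow> real"
  where "signed_integral \<mu> f = (\<integral>x. f x \<partial>pos_part \<mu>) - (\<integral>x. f x \<partial>neg_part \<mu>)"

definition regular_signed_measure :: "('a::topological_space set \<Rightarrow> real) \<Rightarrow> bool"
  where "regular_signed_measure \<mu> \<longleftrightarrow>
    (\<forall>A\<in>sets borel. \<forall>\<epsilon>>0. \<exists>C U. compact C \<and> open U \<and> C \<subseteq> A \<and> A \<subseteq> U \<and>
      total_variation \<mu> (U - C) < \<epsilon>)"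

text \<open>
  The space $M(L)$. Requiring the value 0 on non-Borel sets makes an element of this
  set determined by its values on Borel sets.
\<close>

definition M_space :: "('a::topological_space set \<Rightarrow> real) set"
  where "M_space = {\<mu>. signed_borel_measure \<mu> \<and> regular_signed_measure \<mu> \<and>
    (\<forall>A. A \<notin> sets borel \<longrightarrow> \<mu> A = 0)}"

definition weak_star_null :: "(nat \<Rightarrow> 'a::topological_space set \<Rightarrow> real) \<Rightarrow> bool"
  where "weak_star_null \<mu> \<longleftrightarrow> (\<forall>f::'a \<Rightarrow>\<^sub>C real. (\<lambda>n. signed_integral (\<mu> n) f) \<longlonglongrightarrow> 0)"

subsection \<open>Functions of bounded variation\<close>

definition variation :: "('a::linorder \<Rightarrow> real) \<Rightarrow> ennreal"
  where "variation F = (SUP (n, t)\<in>{(n::nat, t::nat \<Rightarrow> 'a). \<forall>i<n. t i \<le> t (Suc i)}.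
    \<Sum>i<n. ennreal \<bar>F (t (Suc i)) - F (t i)\<bar>)"

definition NBV :: "('a::linorder_topology \<Rightarrow> real) set"
  where "NBV = {F. (\<forall>t. continuous (at_right t) F) \<and> variation F < \<infinity>}"

text \<open>The interval $[0,t]$ is \<open>{..t}\<close>, as 0 is the minimum of the line.\<close>

definition distr_fun :: "('a::linorder_topology set \<Rightarrow> real) \<Rightarrow> 'a \<Rightarrow> real"
  where "distr_fun \<mu> t = \<mu> {..t}"

definition associated_op ::
    "(('a::topological_space \<Rightarrow>\<^sub>C real) \<Rightarrow>\<^sub>L (nat \<Rightarrow>\<^sub>C real)) \<Rightarrow> (nat \<Rightarrow> 'a set \<Rightarrow> real) \<Rightarrow> bool"
  where "associated_op T \<mu> \<longleftrightarrow> (\<forall>f n. T f n = signed_integral (\<mu> n) f)"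

subsection \<open>Internal points and multiple points\<close>

definition internal_point :: "'a::linorder \<Rightarrow> bool"
  where "internal_point x \<longleftrightarrow> \<not> (\<forall>y. x \<le> y) \<and> \<not> (\<forall>y. y \<le> x) \<and>
    (\<forall>y>x. {x<..<y} \<noteq> {}) \<and> (\<forall>y<x. {y<..<x} \<noteq> {})"

text \<open>
  More than one element in the fibre is written out, since \<open>card\<close> is 0 on infinite fibres.
\<close>

definition Q :: "('k \<Rightarrow> 'l) \<Rightarrow> 'l set"
  where "Q \<phi> = {t. \<exists>x y. x \<in> \<phi> -` {t} \<and> y \<in> \<phi> -` {t} \<and> x \<noteq> y}"

definition Q0 :: "('k \<Rightarrow> 'l::linorder) \<Rightarrow> 'l set"
  where "Q0 \<phi> = {t \<in> Q \<phi>. internal_point t}"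

end

theory Submission
  imports Defs
begin

text \<open>
  Write \<open>a\<^sub>t\<close> and \<open>b\<^sub>t\<close> for the end points of the fibre of \<open>\<phi>\<close> over \<open>t\<close>. The reason for the theorem is that
  $C(K)$ exceeds $\phi^*C(L)$ only by functions living on single fibres: the functions that are constant
  to the left of some \<open>a\<close> and to the right of some \<open>b\<close> with \<open>\<phi> a = \<phi> b\<close> span, together with
  $\phi^*C(L)$, a dense subspace (\<open>closed_subspace_eq_UNIV\<close>). An extension \<open>T'\<close> is thus a
  choice of functionals on these pieces, and \<open>F\<^sub>n t\<close>, the measure of \<open>[0,t]\<close>, is the natural value at a
  function that descends from 1 to 0 inside the fibre over \<open>t\<close>.

  Necessity (\<open>countable_if_extension\<close>). For \<open>t\<close> in \<open>Q \<phi>\<close> let \<open>u\<^sub>t\<close> be a continuous function on \<open>K\<close> that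
  descends from 1 to 0 within the fibre over \<open>t\<close>. Then \<open>(T' u\<^sub>t)(n)\<close> tends to 0. For each \<open>n\<close> it
  equals \<open>F\<^sub>n t\<close> for all but countably many \<open>t\<close>: if the two differ by at least \<open>e\<close> at \<open>m\<close> points, then
  subtracting from \<open>u\<^sub>t\<close> a suitable continuous approximation on \<open>L\<close> of the indicator of \<open>[0,t]\<close> gives
  \<open>m\<close> disjointly supported functions bounded by 1, at each of which the \<open>n\<close>-th coordinate of \<open>T'\<close> has
  absolute value at least \<open>e/2\<close>, so \<open>m e/2\<close> is bounded by the norm of \<open>T'\<close>.

  Sufficiency (\<open>extension_if_countable\<close>). Integrating \<open>f(a\<^sub>t)\<close> against \<open>\<mu>\<^sub>n\<close> extends the \<open>n\<close>-th
  coordinate of \<open>T\<close> to \<open>C(K)\<close> without increasing the norm. These functionals \<open>\<nu>\<^sub>n\<close> tend to 0 at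
  every function living on the fibre over \<open>t\<close> as soon as \<open>F\<^sub>n t\<close> tends to 0. So the vectors at which they
  tend to 0 together with the countably many \<open>u\<^sub>t\<close> with \<open>t\<close> bad have dense span, and Veech's
  argument for Sobczyk's theorem (\<open>Sobczyk_correction\<close>) corrects \<open>\<nu>\<^sub>n\<close> to a pointwise null
  sequence at the price of the factor 2, without changing it on $\phi^*C(L)$.

  Finally, a bad point that is not internal is the minimum of \<open>L\<close> or an atom of some \<open>\<mu>\<^sub>n\<close>, since
  indicators of clopen sets are continuous; there are only countably many such points
  (\<open>countable_bad_iff_internal\<close>).
\<close>

section \<open>Jordan decomposition of a signed Borel measure\<close>

lemma signed_borel_measure_empty:
  assumes "signed_borel_measure \<mu>"
  shows "\<mu> {} = 0"
proof -
  have "(\<lambda>n::nat. \<mu> {}) sums \<mu> {}"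
    using assms[unfolded signed_borel_measure_def, rule_format, of "\<lambda>_. {}"]
    by (auto simp: disjoint_family_on_def)
  then have "(\<lambda>n::nat. \<mu> {}) \<longlonglongrightarrow> 0"
    using sums_summable summable_LIMSEQ_zero by blast
  then show ?thesis
    by (simp add: LIMSEQ_const_iff)
qed

lemma signed_borel_measure_Un:
  assumes "signed_borel_measure \<mu>" "A \<in> sets borel" "B \<in> sets borel" "A \<inter> B = {}"
  shows "\<mu> (A \<union> B) = \<mu> A + \<mu> B"
proof -
  have "range (binaryset A B) \<subseteq> sets borel" "disjoint_family (binaryset A B)"
    using assms by (auto simp: range_binaryset_eq disjoint_family_on_def binaryset_def)
  then have "(\<lambda>n. \<mu> (binaryset A B n)) sums \<mu> (A \<union> B)"
    using assms(1) UN_binaryset_eq[of A B] unfolding signed_borel_measure_def by metis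
  moreover have "(\<lambda>n. \<mu> (binaryset A B n)) sums (\<mu> A + \<mu> B)"
    by (rule binaryset_sums) (rule signed_borel_measure_empty[OF assms(1)])
  ultimately show ?thesis
    by (rule sums_unique2)
qed

lemma signed_borel_measure_Diff:
  assumes "signed_borel_measure \<mu>" "A \<in> sets borel" "B \<in> sets borel" "B \<subseteq> A"
  shows "\<mu> (A - B) = \<mu> A - \<mu> B"
  using signed_borel_measure_Un[OF assms(1,3), of "A - B"] assms
  by (simp add: Un_absorb1 sets.Diff)

lemma signed_borel_measure_uminus:
  assumes "signed_borel_measure \<mu>"
  shows "signed_borel_measure (\<lambda>A. - \<mu> A)"
  using assms unfolding signed_borel_measure_def by (auto intro: sums_minus)

lemma ennreal_sum_le: "ennreal (\<Sum>i<n::nat. f i) \<le> (\<Sum>i<n. ennreal (f i))"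
proof (induction n)
  case (Suc n)
  have "ennreal (a + b) \<le> ennreal a + ennreal b" for a b
    by (cases "a \<ge> 0"; cases "b \<ge> 0")
       (auto simp: ennreal_plus[symmetric] ennreal_neg intro!: ennreal_leI simp del: ennreal_plus)
  from this[of "sum f {..<n}" "f n"] show ?case
    using order_trans[OF _ add_right_mono[OF Suc]] by simp
qed simp

text \<open>
  The supremum defining the positive part is countably additive: a Borel subset of a disjoint union
  splits into its traces on the pieces, which bounds the union by the sum, while choosing
  near-optimal subsets of finitely many pieces gives the converse. As \<open>measure_of\<close> yields the zero
  measure when its argument is not countably additive, all values below depend on this.
\<close>

lemma
  assumes signed: "signed_borel_measure \<mu>"
  shows sets_pos_part: "sets (pos_part \<mu>) = sets borel"
    and space_pos_part: "space (pos_part \<mu>) = UNIV"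
    and emeasure_pos_part: "A \<in> sets borel \<Longrightarrow>
      emeasure (pos_part \<mu>) A = (SUP B\<in>{B \<in> sets borel. B \<subseteq> A}. ennreal (\<mu> B))"
proof -
  have borel: "sigma_sets UNIV (sets borel) = sets (borel :: 'a measure)"
    using sets.sigma_sets_eq[of borel] by simp
  show "sets (pos_part \<mu>) = sets borel"
    unfolding pos_part_def by (subst sets_measure_of) (auto simp: borel)
  show "space (pos_part \<mu>) = UNIV"
    unfolding pos_part_def by (rule space_measure_of) auto
  assume A: "A \<in> sets borel"
  define v where "v = (\<lambda>A. SUP B\<in>{B \<in> sets borel. B \<subseteq> A}. ennreal (\<mu> B))"
  have vI: "ennreal (\<mu> B) \<le> v A" if "B \<in> sets borel" "B \<subseteq> A" for A B
    unfolding v_def by (rule SUP_upper) (use that in auto)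
  have v_least: "v A \<le> c" if "\<And>B. B \<in> sets borel \<Longrightarrow> B \<subseteq> A \<Longrightarrow> ennreal (\<mu> B) \<le> c" for A c
    unfolding v_def by (rule SUP_least) (use that in auto)
  have v0: "v {} = 0"
  proof -
    have "{B \<in> sets borel. B \<subseteq> {}} = {{} :: 'a set}" by auto
    then show ?thesis
      by (simp add: v_def signed_borel_measure_empty[OF signed])
  qed
  have super: "v A + v B \<le> v (A \<union> B)"
    if AB: "A \<in> sets borel" "B \<in> sets borel" "A \<inter> B = {}" for A B
  proof -
    have *: "ennreal (\<mu> C) + ennreal (\<mu> D) \<le> v (A \<union> B)"
      if "C \<in> {C \<in> sets borel. C \<subseteq> A}" "D \<in> {D \<in> sets borel. D \<subseteq> B}" for C D
    proof -
      \<comment> \<open>\<open>ennreal\<close> truncates negative values, so a set with negative value may be traded for \<open>{}\<close>.\<close>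
      define C' where "C' = (if \<mu> C \<ge> 0 then C else {})"
      define D' where "D' = (if \<mu> D \<ge> 0 then D else {})"
      have "ennreal (\<mu> C) + ennreal (\<mu> D) = ennreal (\<mu> C' + \<mu> D')"
        by (auto simp: C'_def D'_def signed_borel_measure_empty[OF signed] ennreal_neg)
      also have "\<mu> C' + \<mu> D' = \<mu> (C' \<union> D')"
        by (rule signed_borel_measure_Un[symmetric, OF signed])
           (use that AB in \<open>auto simp: C'_def D'_def\<close>)
      also have "ennreal \<dots> \<le> v (A \<union> B)"
        by (rule vI) (use that in \<open>auto simp: C'_def D'_def\<close>)
      finally show ?thesis .
    qed
    have ne: "{C \<in> sets borel. C \<subseteq> X} \<noteq> {}" for X :: "'a set" by blast
    have "v A + v B = (SUP C\<in>{C \<in> sets borel. C \<subseteq> A}. ennreal (\<mu> C) + v B)"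
      unfolding v_def by (rule ennreal_SUP_add_left[OF ne, symmetric])
    also have "\<dots> =
        (SUP C\<in>{C \<in> sets borel. C \<subseteq> A}. SUP D\<in>{D \<in> sets borel. D \<subseteq> B}. ennreal (\<mu> C) + ennreal (\<mu> D))"
      unfolding v_def by (subst ennreal_SUP_add_right[OF ne]) (rule refl)
    also have "\<dots> \<le> v (A \<union> B)"
      by (intro SUP_least *)
    finally show ?thesis .
  qed
  have "countably_additive (sets borel) v"
    unfolding countably_additive_def
  proof (intro allI impI antisym)
    fix A :: "nat \<Rightarrow> 'a set"
    assume A: "range A \<subseteq> sets borel" "disjoint_family A" "(\<Union>i. A i) \<in> sets borel"
    have fin: "(\<Sum>i<n. v (A i)) \<le> v (\<Union>i<n. A i)" for n
    proof (induction n)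
      case (Suc n)
      have "(\<Union>i<n. A i) \<inter> A n = {}"
      proof (rule equals0I)
        fix x assume "x \<in> (\<Union>i<n. A i) \<inter> A n"
        then obtain i where "i < n" "x \<in> A i" "x \<in> A n" by blast
        then show False
          using disjoint_family_onD[OF A(2), of i n] by blast
      qed
      then have "v (\<Union>i<n. A i) + v (A n) \<le> v ((\<Union>i<n. A i) \<union> A n)"
        using A(1) by (intro super) auto
      moreover have "(\<Union>i<n. A i) \<union> A n = (\<Union>i<Suc n. A i)"
        by (simp add: lessThan_Suc Un_commute)
      ultimately have "v (\<Union>i<n. A i) + v (A n) \<le> v (\<Union>i<Suc n. A i)" by simp
      with add_right_mono[OF Suc] have "(\<Sum>i<n. v (A i)) + v (A n) \<le> v (\<Union>i<Suc n. A i)"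
        by (rule order_trans)
      then show ?case
        by simp
    qed (simp add: v0)
    show "(\<Sum>i. v (A i)) \<le> v (\<Union>i. A i)"
    proof (rule suminf_le_const)
      fix n
      have "v (\<Union>i<n. A i) \<le> v (\<Union>i. A i)"
        unfolding v_def by (rule SUP_subset_mono) auto
      then show "(\<Sum>i<n. v (A i)) \<le> v (\<Union>i. A i)"
        using fin[of n] by (rule order_trans[rotated])
    qed simp
    show "v (\<Union>i. A i) \<le> (\<Sum>i. v (A i))"
    proof (rule v_least)
      fix B assume B: "B \<in> sets borel" "B \<subseteq> (\<Union>i. A i)"
      have "(\<lambda>n. \<mu> (B \<inter> A n)) sums \<mu> (\<Union>n. B \<inter> A n)"
      proof (rule signed[unfolded signed_borel_measure_def, rule_format])
        show "range (\<lambda>n. B \<inter> A n) \<subseteq> sets borel"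
          using B A by auto
        show "disjoint_family (\<lambda>n. B \<inter> A n)"
          by (rule disjoint_family_on_bisimulation[OF A(2)]) auto
      qed
      moreover have "(\<Union>n. B \<inter> A n) = B" using B by auto
      ultimately have "(\<lambda>n. \<Sum>i<n. \<mu> (B \<inter> A i)) \<longlonglongrightarrow> \<mu> B"
        by (simp add: sums_def)
      then have "(\<lambda>n. ennreal (\<Sum>i<n. \<mu> (B \<inter> A i))) \<longlonglongrightarrow> ennreal (\<mu> B)"
        by (rule tendsto_ennrealI)
      moreover have "ennreal (\<Sum>i<n. \<mu> (B \<inter> A i)) \<le> (\<Sum>i. v (A i))" for n
      proof -
        have "ennreal (\<Sum>i<n. \<mu> (B \<inter> A i)) \<le> (\<Sum>i<n. ennreal (\<mu> (B \<inter> A i)))"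
          by (rule ennreal_sum_le)
        also have "\<dots> \<le> (\<Sum>i<n. v (A i))"
          by (intro sum_mono vI) (use A B in auto)
        also have "\<dots> \<le> (\<Sum>i. v (A i))"
          by (rule sum_le_suminf) auto
        finally show ?thesis .
      qed
      ultimately show "ennreal (\<mu> B) \<le> (\<Sum>i. v (A i))"
        by (intro LIMSEQ_le_const2) auto
    qed
  qed
  then have "emeasure (pos_part \<mu>) A = v A"
    unfolding pos_part_def v_def[symmetric]
    by (intro emeasure_measure_of_sigma)
       (use A v0 sets.sigma_algebra_axioms[of "borel :: 'a measure"] in \<open>auto simp: positive_def\<close>)
  then show "emeasure (pos_part \<mu>) A = (SUP B\<in>{B \<in> sets borel. B \<subseteq> A}. ennreal (\<mu> B))"
    by (simp add: v_def)
qed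

section \<open>Regular signed measures on a compact space\<close>

lemma compact_Urysohn:
  fixes S T :: "'a::t2_space set"
  assumes "compact (UNIV :: 'a set)" "closed S" "closed T" "S \<inter> T = {}" "a \<le> (b::real)"
  obtains f :: "'a \<Rightarrow>\<^sub>C real" where "\<And>x. a \<le> f x" "\<And>x. f x \<le> b"
    "\<And>x. x \<in> S \<Longrightarrow> f x = a" "\<And>x. x \<in> T \<Longrightarrow> f x = b"
proof -
  have "Hausdorff_space (euclidean :: 'a topology)"
    unfolding Hausdorff_space_def by (simp add: disjnt_def) (meson hausdorff)
  then have "normal_space (euclidean :: 'a topology)"
    using assms(1) by (intro compact_Hausdorff_or_regular_imp_normal_space) (auto simp: compact_space_def)
  then obtain f where f: "continuous_map euclidean (top_of_set {a..b}) f" "f ` S \<subseteq> {a}" "f ` T \<subseteq> {b}"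
    using Urysohn_lemma[of euclidean S T a b] assms by (auto simp: disjnt_def)
  then have cont: "continuous_on UNIV f" and ran: "f x \<in> {a..b}" for x
    by (auto simp: continuous_map_in_subtopology image_subset_iff)
  have "norm (f x) \<le> max \<bar>a\<bar> \<bar>b\<bar>" for x
    using ran[of x] by auto
  then have "f \<in> bcontfun"
    by (rule bcontfun_normI[OF cont])
  then have "apply_bcontfun (Bcontfun f) = f"
    by (rule Bcontfun_inverse)
  then show thesis
    using f ran by (intro that[of "Bcontfun f"]) auto
qed

text \<open>
  The point \<open>t\<close> itself contributes at most \<open>\<bar>\<mu> {t}\<bar>\<close>, so the positive part is locally finite, and by
  compactness finite. The local hypothesis is what regularity at \<open>{t}\<close> provides.
\<close>

lemma finite_pos_part:
  fixes \<mu> :: "'a::t2_space set \<Rightarrow> real"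
  assumes signed: "signed_borel_measure \<mu>" and compact: "compact (UNIV :: 'a set)"
    and local: "\<And>t. \<exists>U. open U \<and> t \<in> U \<and> emeasure (pos_part \<mu>) (U - {t}) < \<infinity>"
  shows "finite_measure (pos_part \<mu>)"
proof -
  note [simp] = sets_pos_part[OF signed] space_pos_part[OF signed]
  have "\<exists>U. open U \<and> t \<in> U \<and> emeasure (pos_part \<mu>) U < \<infinity>" for t
  proof -
    obtain U where U: "open U" "t \<in> U" "emeasure (pos_part \<mu>) (U - {t}) < \<infinity>"
      using local by blast
    have "emeasure (pos_part \<mu>) {t} \<le> ennreal \<bar>\<mu> {t}\<bar>"
    proof (subst emeasure_pos_part[OF signed], simp, rule SUP_least)
      fix B assume "B \<in> {B \<in> sets borel. B \<subseteq> {t}}"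
      then have "B = {} \<or> B = {t}" by auto
      then show "ennreal (\<mu> B) \<le> ennreal \<bar>\<mu> {t}\<bar>"
        by (auto simp: signed_borel_measure_empty[OF signed] intro: ennreal_leI)
    qed
    then have "emeasure (pos_part \<mu>) {t} < \<infinity>"
      by (rule order_le_less_trans) simp
    moreover have "emeasure (pos_part \<mu>) U \<le> emeasure (pos_part \<mu>) (U - {t}) + emeasure (pos_part \<mu>) {t}"
      using U emeasure_subadditive[of "U - {t}" "pos_part \<mu>" "{t}"] by (simp add: insert_absorb)
    ultimately have "emeasure (pos_part \<mu>) U < \<infinity>"
      using U(3) by (simp add: order_le_less_trans)
    then show ?thesis
      using U by blast
  qed
  then obtain U where U: "\<And>t. open (U t)" "\<And>t. t \<in> U t" "\<And>t. emeasure (pos_part \<mu>) (U t) < \<infinity>"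
    by metis
  obtain D where D: "finite D" "UNIV \<subseteq> (\<Union>t\<in>D. U t)"
  proof (rule compactE_image[OF compact, of UNIV U])
    show "UNIV \<subseteq> (\<Union>t\<in>UNIV. U t)" using U(2) by blast
  qed (use U(1) in auto)
  have "emeasure (pos_part \<mu>) UNIV \<le> emeasure (pos_part \<mu>) (\<Union>t\<in>D. U t)"
    by (rule emeasure_mono) (use D U in auto)
  also have "\<dots> \<le> (\<Sum>t\<in>D. emeasure (pos_part \<mu>) (U t))"
    by (rule emeasure_subadditive_finite) (use D U in auto)
  also have "\<dots> < \<infinity>"
    using D U by (simp add: less_top)
  finally show ?thesis
    by (intro finite_measureI) simp
qed

locale compact_signed_measure =
  fixes \<mu> :: "'a::t2_space set \<Rightarrow> real"
  assumes compact_space: "compact (UNIV :: 'a set)" and M_space: "\<mu> \<in> M_space"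
begin

definition tvar :: "'a set \<Rightarrow> real"
  where "tvar A = measure (pos_part \<mu>) A + measure (neg_part \<mu>) A"

lemma signed: "signed_borel_measure \<mu>" and signed_uminus: "signed_borel_measure (\<lambda>A. - \<mu> A)"
  using M_space by (auto simp: M_space_def intro: signed_borel_measure_uminus)

lemma sets_parts [simp, measurable_cong]:
  "sets (pos_part \<mu>) = sets borel" "sets (neg_part \<mu>) = sets borel"
  using sets_pos_part[OF signed] sets_pos_part[OF signed_uminus] by (auto simp: neg_part_def)

lemma space_parts [simp]: "space (pos_part \<mu>) = UNIV" "space (neg_part \<mu>) = UNIV"
  using space_pos_part[OF signed] space_pos_part[OF signed_uminus] by (auto simp: neg_part_def)

lemma finite_parts: "finite_measure (pos_part \<mu>)" "finite_measure (neg_part \<mu>)"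
proof -
  have *: "\<exists>U. open U \<and> t \<in> U \<and> total_variation \<mu> (U - {t}) < \<infinity>" for t
  proof -
    obtain C U where CU: "compact C" "open U" "C \<subseteq> {t}" "{t} \<subseteq> U" "total_variation \<mu> (U - C) < 1"
      using M_space unfolding M_space_def regular_signed_measure_def
      by (auto dest!: bspec[of _ _ "{t}"] spec[of _ "1::ennreal"])
    have "total_variation \<mu> (U - {t}) \<le> total_variation \<mu> (U - C)"
      unfolding total_variation_def
      by (intro add_mono emeasure_mono)
         (use CU compact_imp_closed[OF CU(1)] in \<open>auto intro!: sets.Diff borel_open borel_closed\<close>)
    then show ?thesis
      using CU by (intro exI[of _ U]) (auto intro: le_less_trans less_trans)
  qed
  have "\<exists>U. open U \<and> t \<in> U \<and> emeasure (pos_part \<mu>) (U - {t}) < \<infinity>"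
    "\<exists>U. open U \<and> t \<in> U \<and> emeasure (pos_part (\<lambda>A. - \<mu> A)) (U - {t}) < \<infinity>" for t
    using *[of t] unfolding total_variation_def neg_part_def by (auto simp: less_top)
  then show "finite_measure (pos_part \<mu>)" "finite_measure (neg_part \<mu>)"
    unfolding neg_part_def
    by (auto intro!: finite_pos_part signed signed_uminus compact_space)
qed

sublocale P: finite_measure "pos_part \<mu>" by (rule finite_parts)
sublocale N: finite_measure "neg_part \<mu>" by (rule finite_parts)

lemma tvar_nonneg: "0 \<le> tvar A"
  by (simp add: tvar_def)

lemma total_variation_eq: "total_variation \<mu> A = ennreal (tvar A)"
  by (simp add: total_variation_def tvar_def P.emeasure_eq_measure N.emeasure_eq_measure)

lemma
  assumes "A \<in> sets borel" "B \<in> sets borel" "B \<subseteq> A"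
  shows le_measure_pos: "\<mu> B \<le> measure (pos_part \<mu>) A"
    and le_measure_neg: "- \<mu> B \<le> measure (neg_part \<mu>) A"
proof -
  have "ennreal (\<mu> B) \<le> emeasure (pos_part \<mu>) A"
    using assms by (subst emeasure_pos_part[OF signed]) (auto intro: SUP_upper)
  then show "\<mu> B \<le> measure (pos_part \<mu>) A"
    by (simp add: P.emeasure_eq_measure ennreal_le_iff)
  have "ennreal (- \<mu> B) \<le> emeasure (neg_part \<mu>) A"
    using assms unfolding neg_part_def by (subst emeasure_pos_part[OF signed_uminus]) (auto intro: SUP_upper)
  then show "- \<mu> B \<le> measure (neg_part \<mu>) A"
    by (simp add: N.emeasure_eq_measure ennreal_le_iff)
qed

lemma
  assumes "A \<in> sets borel"
  shows measure_pos_le: "(\<And>B. B \<in> sets borel \<Longrightarrow> B \<subseteq> A \<Longrightarrow> \<mu> B \<le> c) \<Longrightarrow> measure (pos_part \<mu>) A \<le> c"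
    and measure_neg_le: "(\<And>B. B \<in> sets borel \<Longrightarrow> B \<subseteq> A \<Longrightarrow> - \<mu> B \<le> c) \<Longrightarrow> measure (neg_part \<mu>) A \<le> c"
proof -
  assume c: "\<And>B. B \<in> sets borel \<Longrightarrow> B \<subseteq> A \<Longrightarrow> \<mu> B \<le> c"
  have "emeasure (pos_part \<mu>) A \<le> ennreal c"
    using assms c by (subst emeasure_pos_part[OF signed]) (auto intro!: SUP_least ennreal_leI)
  moreover have "0 \<le> c"
    using c[of "{}"] signed_borel_measure_empty[OF signed] by simp
  ultimately show "measure (pos_part \<mu>) A \<le> c"
    by (simp add: P.emeasure_eq_measure ennreal_le_iff)
next
  assume c: "\<And>B. B \<in> sets borel \<Longrightarrow> B \<subseteq> A \<Longrightarrow> - \<mu> B \<le> c"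
  have "emeasure (neg_part \<mu>) A \<le> ennreal c"
    unfolding neg_part_def
    using assms c by (subst emeasure_pos_part[OF signed_uminus]) (auto intro!: SUP_least ennreal_leI)
  moreover have "0 \<le> c"
    using c[of "{}"] signed_borel_measure_empty[OF signed] by simp
  ultimately show "measure (neg_part \<mu>) A \<le> c"
    by (simp add: N.emeasure_eq_measure ennreal_le_iff)
qed

lemma Jordan_decomposition:
  assumes A: "A \<in> sets borel"
  shows "\<mu> A = measure (pos_part \<mu>) A - measure (neg_part \<mu>) A"
proof (rule antisym)
  have "measure (neg_part \<mu>) A \<le> measure (pos_part \<mu>) A - \<mu> A"
  proof (rule measure_neg_le[OF A])
    fix B assume "B \<in> sets borel" "B \<subseteq> A"
    then show "- \<mu> B \<le> measure (pos_part \<mu>) A - \<mu> A"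
      using A le_measure_pos[of A "A - B"] signed_borel_measure_Diff[OF signed A, of B] by auto
  qed
  then show "\<mu> A \<le> measure (pos_part \<mu>) A - measure (neg_part \<mu>) A" by simp
  have "measure (pos_part \<mu>) A \<le> measure (neg_part \<mu>) A + \<mu> A"
  proof (rule measure_pos_le[OF A])
    fix B assume "B \<in> sets borel" "B \<subseteq> A"
    then show "\<mu> B \<le> measure (neg_part \<mu>) A + \<mu> A"
      using A le_measure_neg[of A "A - B"] signed_borel_measure_Diff[OF signed A, of B] by auto
  qed
  then show "measure (pos_part \<mu>) A - measure (neg_part \<mu>) A \<le> \<mu> A" by simp
qed

lemma regular:
  assumes "A \<in> sets borel" "0 < e"
  obtains C U where "compact C" "open U" "C \<subseteq> A" "A \<subseteq> U" "tvar (U - C) < e"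
proof -
  have "\<exists>C U. compact C \<and> open U \<and> C \<subseteq> A \<and> A \<subseteq> U \<and> total_variation \<mu> (U - C) < ennreal e"
    using M_space assms unfolding M_space_def regular_signed_measure_def by simp
  then show thesis
    using that assms(2) by (auto simp: total_variation_eq ennreal_less_iff tvar_nonneg)
qed

lemma integrable_parts:
  assumes "f \<in> borel_measurable borel" "\<And>x. \<bar>f x\<bar> \<le> (c::real)"
  shows "integrable (pos_part \<mu>) f" "integrable (neg_part \<mu>) f"
  using assms by (auto intro!: P.integrable_const_bound[of _ c] N.integrable_const_bound[of _ c])

lemma signed_integral_add:
  assumes "f \<in> borel_measurable borel" "\<And>x. \<bar>f x\<bar> \<le> (c::real)"
    and "g \<in> borel_measurable borel" "\<And>x. \<bar>g x\<bar> \<le> (d::real)"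
  shows "signed_integral \<mu> (\<lambda>x. f x + g x) = signed_integral \<mu> f + signed_integral \<mu> g"
  using integrable_parts[OF assms(1,2)] integrable_parts[OF assms(3,4)]
  by (simp add: signed_integral_def)

lemma signed_integral_mult: "signed_integral \<mu> (\<lambda>x. a * f x) = a * signed_integral \<mu> f"
  by (simp add: signed_integral_def algebra_simps)

lemma signed_integral_indicator:
  "A \<in> sets borel \<Longrightarrow> signed_integral \<mu> (indicator A) = \<mu> A"
  by (simp add: signed_integral_def Jordan_decomposition)

lemma signed_integral_bound:
  assumes f: "f \<in> borel_measurable borel" and A: "A \<in> sets borel"
    and le: "\<And>x. \<bar>f x\<bar> \<le> c * indicator A x"
  shows "\<bar>signed_integral \<mu> f\<bar> \<le> c * tvar A"
proof -
  have "\<bar>f x\<bar> \<le> \<bar>c\<bar>" for x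
    using le[of x] by (cases "x \<in> A") auto
  note int = integrable_parts[OF f this]
  have ind: "integrable (pos_part \<mu>) (indicat_real A)" "integrable (neg_part \<mu>) (indicat_real A)"
    using A by (auto intro!: integrable_parts[of _ 1])
  have "\<bar>\<integral>x. f x \<partial>pos_part \<mu>\<bar> \<le> (\<integral>x. c * indicator A x \<partial>pos_part \<mu>)"
    by (intro order_trans[OF integral_abs_bound integral_mono]) (use int ind le in auto)
  moreover have "\<bar>\<integral>x. f x \<partial>neg_part \<mu>\<bar> \<le> (\<integral>x. c * indicator A x \<partial>neg_part \<mu>)"
    by (intro order_trans[OF integral_abs_bound integral_mono]) (use int ind le in auto)
  ultimately show ?thesis
    using A by (simp add: signed_integral_def tvar_def algebra_simps)
qed

lemma signed_integral_diff_bound: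
  assumes f: "f \<in> borel_measurable borel" "\<And>x. \<bar>f x\<bar> \<le> b"
    and g: "g \<in> borel_measurable borel" "\<And>x. \<bar>g x\<bar> \<le> b"
    and A: "A \<in> sets borel" and le: "\<And>x. \<bar>f x - g x\<bar> \<le> c * indicator A x"
  shows "\<bar>signed_integral \<mu> f - signed_integral \<mu> g\<bar> \<le> c * tvar A"
proof -
  have "signed_integral \<mu> f - signed_integral \<mu> g = signed_integral \<mu> (\<lambda>x. f x - g x)"
    using integrable_parts[OF f] integrable_parts[OF g] by (simp add: signed_integral_def)
  then show ?thesis
    using signed_integral_bound[OF _ A le] f(1) g(1) by simp
qed

lemma measurable_bcontfun: "apply_bcontfun (g :: 'a \<Rightarrow>\<^sub>C real) \<in> borel_measurable borel"
  by (intro borel_measurable_continuous_onI continuous_on_apply_bcontfun)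

text \<open>
  The inequality $\Vert\mu\Vert\le c$ of the Riesz representation theorem: a Borel set almost attaining the
  positive part is almost a Hahn decomposition; regularity and Urysohn's lemma replace the sign
  function by a continuous one, off a set of variation below \<open>e\<close>.
\<close>

lemma tvar_le:
  assumes c: "\<And>g :: 'a \<Rightarrow>\<^sub>C real. (\<And>x. \<bar>g x\<bar> \<le> 1) \<Longrightarrow> signed_integral \<mu> g \<le> c"
  shows "tvar UNIV \<le> c"
proof (rule field_le_epsilon)
  fix e' :: real assume "0 < e'"
  \<comment> \<open>The choice of \<open>B\<close> loses \<open>e\<close>, doubled by passing to the complement, and so does the choice of \<open>g\<close>.\<close>
  define e where "e = e' / 4"
  have "0 < e" using \<open>0 < e'\<close> by (simp add: e_def)
  obtain B where B: "B \<in> sets borel" "\<mu> B > measure (pos_part \<mu>) UNIV - e"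
  proof (rule ccontr)
    assume "\<not> thesis"
    then have "measure (pos_part \<mu>) UNIV \<le> measure (pos_part \<mu>) UNIV - e"
      using that by (intro measure_pos_le) force+
    then show False
      using \<open>0 < e\<close> by simp
  qed
  obtain C U where CU: "compact C" "open U" "C \<subseteq> B" "B \<subseteq> U" "tvar (U - C) < e"
    using regular[OF B(1) \<open>0 < e\<close>] .
  have "closed C" using CU by (simp add: compact_imp_closed)
  obtain g :: "'a \<Rightarrow>\<^sub>C real" where g: "\<And>x. -1 \<le> g x" "\<And>x. g x \<le> 1"
    "\<And>x. x \<in> -U \<Longrightarrow> g x = -1" "\<And>x. x \<in> C \<Longrightarrow> g x = 1"
    using compact_Urysohn[OF compact_space, of "-U" C "-1" 1] CU \<open>closed C\<close> by (auto simp: closed_Compl)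
  define f where "f = (\<lambda>x. indicator B x + (-1) * indicator (-B) x :: real)"
  have f: "f \<in> borel_measurable borel" "\<bar>f x\<bar> \<le> 1" for x
    using B(1) by (auto simp: f_def indicator_def)
  have fg: "\<bar>f x - g x\<bar> \<le> 2 * indicator (U - C) x" for x
    using g(1,2)[of x] g(3,4)[of x] CU by (auto simp: f_def indicator_def)
  have "signed_integral \<mu> f = \<mu> B + (-1) * \<mu> (-B)"
    unfolding f_def
    using B(1) signed_integral_indicator[of B] signed_integral_indicator[of "-B"]
      signed_integral_mult[of "-1" "indicator (-B)"]
    by (subst signed_integral_add[of _ 1 _ 1]) (auto simp: indicator_def)
  also have "\<mu> (-B) = \<mu> UNIV - \<mu> B"
    using signed_borel_measure_Diff[OF signed _ B(1), of UNIV] by (simp add: Compl_eq_Diff_UNIV)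
  finally have "signed_integral \<mu> f = 2 * \<mu> B - \<mu> UNIV" by simp
  moreover have "\<mu> UNIV = measure (pos_part \<mu>) UNIV - measure (neg_part \<mu>) UNIV"
    by (rule Jordan_decomposition) simp
  ultimately have "tvar UNIV - 2 * e < signed_integral \<mu> f"
    using B(2) by (simp add: tvar_def)
  moreover have "\<bar>signed_integral \<mu> f - signed_integral \<mu> g\<bar> \<le> 2 * tvar (U - C)"
    using f g(1,2) fg CU \<open>closed C\<close>
    by (intro signed_integral_diff_bound[of f 1 g "U - C" 2] measurable_bcontfun)
       (auto simp: abs_le_iff minus_le_iff)
  moreover have "signed_integral \<mu> g \<le> c"
    by (rule c) (use g(1,2) in \<open>auto simp: abs_le_iff minus_le_iff\<close>)
  ultimately show "tvar UNIV \<le> c + e'"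
    using CU(5) by (simp add: e_def)
qed

text \<open>
  Outer regularity in functional form. The set \<open>Z\<close> lets several approximations on a line be given
  disjoint supports beyond the sets that they approximate.
\<close>

lemma cutoff_approximation:
  assumes S: "closed S" and Z: "closed Z" "S \<inter> Z = {}" and e: "0 < e"
  obtains g :: "'a \<Rightarrow>\<^sub>C real" where "\<And>x. 0 \<le> g x" "\<And>x. g x \<le> 1"
    "\<And>x. x \<in> S \<Longrightarrow> g x = 1" "\<And>x. x \<in> Z \<Longrightarrow> g x = 0" "\<bar>signed_integral \<mu> g - \<mu> S\<bar> < e"
proof -
  have Sb: "S \<in> sets borel" using S by simp
  obtain C U where CU: "compact C" "open U" "C \<subseteq> S" "S \<subseteq> U" "tvar (U - C) < e"
    using regular[OF Sb e] .
  have "closed C" using CU by (simp add: compact_imp_closed)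
  obtain g :: "'a \<Rightarrow>\<^sub>C real" where g: "\<And>x. 0 \<le> g x" "\<And>x. g x \<le> 1"
    "\<And>x. x \<in> -U \<union> Z \<Longrightarrow> g x = 0" "\<And>x. x \<in> S \<Longrightarrow> g x = 1"
  proof (rule compact_Urysohn[OF compact_space, of "-U \<union> Z" S 0 1])
    show "closed (-U \<union> Z)" "(-U \<union> Z) \<inter> S = {}"
      using CU Z by (auto simp: closed_Compl)
  qed (use S in auto)
  have "\<bar>g x - indicator S x\<bar> \<le> 1 * indicator (U - C) x" for x
    using g(1,2)[of x] g(3,4)[of x] CU by (auto simp: indicator_def)
  then have "\<bar>signed_integral \<mu> g - signed_integral \<mu> (indicator S)\<bar> \<le> 1 * tvar (U - C)"
    using g(1,2) CU \<open>closed C\<close> Sb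
    by (intro signed_integral_diff_bound[of g 1 "indicator S" "U - C" 1] measurable_bcontfun)
       (auto simp: abs_le_iff minus_le_iff indicator_def intro: order_trans[of _ 0])
  then have "\<bar>signed_integral \<mu> g - \<mu> S\<bar> < e"
    using CU(5) signed_integral_indicator[OF Sb] by simp
  then show thesis
    using that[of g] g by simp
qed

lemma countable_atoms: "countable {t. \<mu> {t} \<noteq> 0}"
proof (rule countable_subset)
  show "{t. \<mu> {t} \<noteq> 0} \<subseteq> {t. measure (pos_part \<mu>) {t} \<noteq> 0} \<union> {t. measure (neg_part \<mu>) {t} \<noteq> 0}"
    by (auto simp: Jordan_decomposition)
qed (intro countable_Un P.countable_support N.countable_support)

end

section \<open>Sobczyk's theorem with a countable set of additional vectors\<close>

lemma blinfun_bound_by: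
  fixes \<nu> :: "'a::real_normed_vector \<Rightarrow>\<^sub>L real"
  assumes "norm \<nu> \<le> C"
  shows "\<bar>\<nu> x\<bar> \<le> C * norm x"
  using order_trans[OF norm_blinfun[of \<nu> x] mult_right_mono[OF assms norm_ge_zero]] by simp

lemma tendsto_zero_approximation:
  fixes f :: "nat \<Rightarrow> real"
  assumes "\<And>e. 0 < e \<Longrightarrow> \<exists>g. g \<longlonglongrightarrow> 0 \<and> (\<forall>n. \<bar>f n - g n\<bar> \<le> e)"
  shows "f \<longlonglongrightarrow> 0"
proof (rule LIMSEQ_I)
  fix r :: real assume "0 < r"
  then obtain g where g: "g \<longlonglongrightarrow> 0" "\<And>n. \<bar>f n - g n\<bar> \<le> r / 2"
    using assms[of "r / 2"] by auto
  obtain N where N: "\<And>n. n \<ge> N \<Longrightarrow> \<bar>g n\<bar> < r / 2"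
    using LIMSEQ_D[OF g(1), of "r / 2"] \<open>0 < r\<close> by auto
  show "\<exists>N. \<forall>n\<ge>N. norm (f n - 0) < r"
  proof (intro exI[of _ N] allI impI)
    fix n assume "N \<le> n"
    then show "norm (f n - 0) < r"
      using N[of n] g(2)[of n] unfolding real_norm_def by linarith
  qed
qed

definition null_vectors :: "(nat \<Rightarrow> 'a::real_normed_vector \<Rightarrow>\<^sub>L real) \<Rightarrow> 'a set"
  where "null_vectors \<nu> = {x. (\<lambda>n. \<nu> n x) \<longlonglongrightarrow> 0}"

lemma subspace_null_vectors: "subspace (null_vectors \<nu>)"
  unfolding null_vectors_def subspace_def
  by (auto simp: blinfun.add_right blinfun.scaleR_right intro: tendsto_eq_intros)

lemma closed_null_vectors:
  assumes "\<And>n. norm (\<nu> n) \<le> C"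
  shows "closed (null_vectors \<nu>)"
proof -
  have "C \<ge> 0" using norm_ge_zero[of "\<nu> 0"] assms[of 0] by linarith
  have "x \<in> null_vectors \<nu>" if x: "x \<in> closure (null_vectors \<nu>)" for x
    unfolding null_vectors_def mem_Collect_eq
  proof (rule tendsto_zero_approximation)
    fix e :: real assume "0 < e"
    then have "0 < e / (C + 1)" using \<open>C \<ge> 0\<close> by simp
    then obtain y where y: "y \<in> null_vectors \<nu>" "dist y x < e / (C + 1)"
      using x unfolding closure_approachable by blast
    have "\<bar>\<nu> n x - \<nu> n y\<bar> \<le> e" for n
    proof -
      have "\<bar>\<nu> n x - \<nu> n y\<bar> \<le> C * norm (x - y)"
        using blinfun_bound_by[OF assms, of n "x - y"] by (simp add: blinfun.diff_right)
      also have "\<dots> \<le> (C + 1) * (e / (C + 1))"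
        using y(2) \<open>C \<ge> 0\<close> \<open>0 < e\<close> by (intro mult_mono) (auto simp: dist_norm norm_minus_commute)
      finally show ?thesis using \<open>C \<ge> 0\<close> by simp
    qed
    then show "\<exists>g. g \<longlonglongrightarrow> 0 \<and> (\<forall>n. \<bar>\<nu> n x - g n\<bar> \<le> e)"
      using y(1) unfolding null_vectors_def by blast
  qed
  then show ?thesis
    using closure_subset_eq by blast
qed

lemma subspace_closure:
  fixes S :: "'a::real_normed_vector set"
  assumes "subspace S"
  shows "subspace (closure S)"
  unfolding subspace_def
proof (intro conjI ballI allI)
  show "0 \<in> closure S"
    using subspace_0[OF assms] closure_subset by blast
  fix x assume "x \<in> closure S"
  then obtain f where f: "\<And>n. f n \<in> S" "f \<longlonglongrightarrow> x"
    unfolding closure_sequential by blast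
  show "c *\<^sub>R x \<in> closure S" for c
    unfolding closure_sequential
    using subspace_scale[OF assms f(1)] tendsto_scaleR[OF tendsto_const f(2)]
    by (intro exI[of _ "\<lambda>n. c *\<^sub>R f n"]) simp
  fix y assume "y \<in> closure S"
  then obtain g where g: "\<And>n. g n \<in> S" "g \<longlonglongrightarrow> y"
    unfolding closure_sequential by blast
  show "x + y \<in> closure S"
    unfolding closure_sequential
    using subspace_add[OF assms f(1) g(1)] tendsto_add[OF f(2) g(2)]
    by (intro exI[of _ "\<lambda>n. f n + g n"]) simp
qed

text \<open>
  A bounded sequence of functionals that converges on a set with dense span converges everywhere.
  It produces the weak* limit points in the proof of Sobczyk's theorem.
\<close>

lemma pointwise_limit_functional:
  fixes \<nu> :: "nat \<Rightarrow> 'a::real_normed_vector \<Rightarrow>\<^sub>L real"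
  assumes C: "\<And>n. norm (\<nu> n) \<le> C"
    and conv: "\<And>x. x \<in> H \<Longrightarrow> convergent (\<lambda>n. \<nu> n x)"
    and dense: "closure (span H) = UNIV"
  obtains \<rho> where "norm \<rho> \<le> C" "\<And>x. (\<lambda>n. \<nu> n x) \<longlonglongrightarrow> blinfun_apply \<rho> x"
proof -
  have "C \<ge> 0" using norm_ge_zero[of "\<nu> 0"] C[of 0] by linarith
  have "span H \<subseteq> {x. convergent (\<lambda>n. \<nu> n x)}"
  proof (rule span_minimal)
    show "subspace {x. convergent (\<lambda>n. \<nu> n x)}"
      unfolding subspace_def
      by (auto simp: blinfun.add_right blinfun.scaleR_right blinfun.zero_right
          intro: convergent_add convergent_mult convergent_const)
  qed (use conv in auto)
  then have span: "convergent (\<lambda>n. \<nu> n x)" if "x \<in> span H" for x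
    using that by blast
  have "Cauchy (\<lambda>n. \<nu> n x)" for x
    unfolding Cauchy_def
  proof (intro allI impI)
    fix e :: real assume "0 < e"
    then have "0 < e / (3 * (C + 1))" using \<open>C \<ge> 0\<close> by simp
    then obtain y where y: "y \<in> span H" "dist y x < e / (3 * (C + 1))"
      using dense closure_approachable[of x "span H"] by auto
    have *: "\<bar>\<nu> n x - \<nu> n y\<bar> < e / 3" for n
    proof -
      have "\<bar>\<nu> n x - \<nu> n y\<bar> \<le> C * norm (x - y)"
        using blinfun_bound_by[OF C, of n "x - y"] by (simp add: blinfun.diff_right)
      also have "\<dots> \<le> (C + 1) * norm (x - y)"
        by (intro mult_right_mono) auto
      also have "\<dots> < (C + 1) * (e / (3 * (C + 1)))"
        using y(2) \<open>C \<ge> 0\<close> by (intro mult_strict_left_mono) (auto simp: dist_norm norm_minus_commute)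
      also have "\<dots> = e / 3" using \<open>C \<ge> 0\<close> by (simp add: field_simps)
      finally show ?thesis .
    qed
    have "Cauchy (\<lambda>n. \<nu> n y)"
      using span[OF y(1)] by (rule convergent_Cauchy)
    then obtain N where N: "\<And>m n. m \<ge> N \<Longrightarrow> n \<ge> N \<Longrightarrow> dist (\<nu> m y) (\<nu> n y) < e / 3"
      using \<open>0 < e\<close> unfolding Cauchy_def by (meson divide_pos_pos zero_less_numeral)
    show "\<exists>N. \<forall>m\<ge>N. \<forall>n\<ge>N. dist (\<nu> m x) (\<nu> n x) < e"
    proof (intro exI[of _ N] allI impI)
      fix m n assume "N \<le> m" "N \<le> n"
      then show "dist (\<nu> m x) (\<nu> n x) < e"
        using N[of m n] *[of m] *[of n] unfolding dist_real_def by linarith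
    qed
  qed
  define r where "r = (\<lambda>x. lim (\<lambda>n. \<nu> n x))"
  have lim: "(\<lambda>n. \<nu> n x) \<longlonglongrightarrow> r x" for x
    using \<open>\<And>x. Cauchy (\<lambda>n. \<nu> n x)\<close> by (simp add: r_def Cauchy_convergent_iff convergent_LIMSEQ_iff)
  have "r (x + y) = r x + r y" for x y
    using LIMSEQ_unique[OF lim[of "x + y"]] tendsto_add[OF lim[of x] lim[of y]]
    by (simp add: blinfun.add_right)
  moreover have "r (a *\<^sub>R x) = a *\<^sub>R r x" for a x
    using LIMSEQ_unique[OF lim[of "a *\<^sub>R x"]] tendsto_mult[OF tendsto_const[of a] lim[of x]]
    by (simp add: blinfun.scaleR_right)
  moreover have bound: "norm (r x) \<le> C * norm x" for x
  proof (rule LIMSEQ_le_const2)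
    show "(\<lambda>n. norm (\<nu> n x)) \<longlonglongrightarrow> norm (r x)"
      by (intro tendsto_norm lim)
    show "\<exists>N. \<forall>n\<ge>N. norm (\<nu> n x) \<le> C * norm x"
      using blinfun_bound_by[OF C] by simp
  qed
  ultimately have "bounded_linear r"
    by (intro bounded_linear_intro[of r C]) (auto simp: mult.commute)
  then have Blinfun_r: "blinfun_apply (Blinfun r) x = r x" for x
    by (simp add: bounded_linear_Blinfun_apply)
  show thesis
  proof (rule that[of "Blinfun r"])
    show "norm (Blinfun r) \<le> C"
      by (rule norm_blinfun_bound[OF \<open>C \<ge> 0\<close>]) (use bound in \<open>simp add: Blinfun_r\<close>)
  qed (use lim in \<open>simp add: Blinfun_r\<close>)
qed

text \<open>
  Let \<open>N\<close> be the set of functionals of norm at most \<open>C\<close> that vanish on \<open>null_vectors \<nu>\<close>. Every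
  subsequence of \<open>\<nu>\<close> has a further subsequence that converges on the countable set \<open>H\<close>, hence everywhere, and
  its limit lies in \<open>N\<close>. Thus the distance from \<open>\<nu> n\<close> to \<open>N\<close> tends to 0 when measured by the values on
  \<open>H\<close>, and \<open>\<rho> n\<close> may be taken to be an almost nearest point of \<open>N\<close>.
\<close>

theorem Sobczyk_correction:
  fixes \<nu> :: "nat \<Rightarrow> 'a::real_normed_vector \<Rightarrow>\<^sub>L real"
  assumes C: "\<And>n. norm (\<nu> n) \<le> C"
    and H: "countable H" and dense: "closure (span (null_vectors \<nu> \<union> H)) = UNIV"
  obtains \<rho> where "\<And>n. norm (\<rho> n) \<le> C" "\<And>n x. x \<in> null_vectors \<nu> \<Longrightarrow> blinfun_apply (\<rho> n) x = 0"
    "null_vectors (\<lambda>n. \<nu> n - \<rho> n) = UNIV"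
proof -
  have "C \<ge> 0" using norm_ge_zero[of "\<nu> 0"] C[of 0] by linarith
  \<comment> \<open>Adding 0 guards against an empty \<open>H\<close>, which has no enumeration.\<close>
  define h where "h = from_nat_into (insert 0 H)"
  have h: "range h = insert 0 H"
    unfolding h_def by (rule range_from_nat_into) (use H in auto)
  define N where "N = {\<rho> :: 'a \<Rightarrow>\<^sub>L real. norm \<rho> \<le> C \<and> (\<forall>x\<in>null_vectors \<nu>. blinfun_apply \<rho> x = 0)}"
  \<comment> \<open>The values on \<open>H\<close> as a point of \<open>nat \<Rightarrow> real\<close>, whose product topology is metrized by a
    translation-invariant distance.\<close>
  define coord where "coord = (\<lambda>(\<rho> :: 'a \<Rightarrow>\<^sub>L real) k. blinfun_apply \<rho> (h k))"
  have "0 \<in> N" using \<open>C \<ge> 0\<close> by (simp add: N_def)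
  then have ne: "coord ` N \<noteq> {}" by blast
  have infdist_null: "(\<lambda>n. infdist (coord (\<nu> n)) (coord ` N)) \<longlonglongrightarrow> 0"
  proof (rule ccontr)
    assume "\<not> ?thesis"
    then obtain e where "0 < e" and e: "\<And>M. \<exists>n\<ge>M. e \<le> infdist (coord (\<nu> n)) (coord ` N)"
      unfolding LIMSEQ_def dist_real_def by (auto simp: infdist_nonneg not_less)
    then have "infinite {n. e \<le> infdist (coord (\<nu> n)) (coord ` N)}"
      unfolding infinite_nat_iff_unbounded_le by auto
    then obtain r :: "nat \<Rightarrow> nat" where r: "strict_mono r"
        "\<And>n. e \<le> infdist (coord (\<nu> (r n))) (coord ` N)"
      using infinite_enumerate by blast
    define B where "B = PiE UNIV (\<lambda>k. cball 0 (C * norm (h k)) :: real set)"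
    have "compactin (product_topology (\<lambda>k. euclidean) UNIV) B"
      unfolding B_def by (simp add: compactin_PiE)
    then have "compact B"
      by (simp add: euclidean_product_topology)
    moreover have "coord (\<nu> (r n)) \<in> B" for n
      using blinfun_bound_by[OF C] by (auto simp: B_def coord_def)
    ultimately obtain l s where s: "strict_mono s" "((\<lambda>n. coord (\<nu> (r n))) \<circ> s) \<longlonglongrightarrow> l"
      using compact_imp_seq_compact seq_compactE by (metis (no_types, lifting))
    have "(\<lambda>n. \<nu> (r (s n)) (h k)) \<longlonglongrightarrow> l k" for k
    proof -
      have "continuous_on UNIV (\<lambda>v :: nat \<Rightarrow> real. v k)"
        by (rule continuous_on_product_coordinates)
      then have "(\<lambda>n. ((\<lambda>n. coord (\<nu> (r n))) \<circ> s) n k) \<longlonglongrightarrow> l k"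
        by (rule continuous_on_tendsto_compose[OF _ s(2)]) simp_all
      then show ?thesis by (simp add: coord_def)
    qed
    then have convH: "convergent (\<lambda>n. \<nu> (r (s n)) x)" if "x \<in> H" for x
    proof -
      have "x \<in> range h" using that h by blast
      then show ?thesis
        using \<open>\<And>k. (\<lambda>n. \<nu> (r (s n)) (h k)) \<longlonglongrightarrow> l k\<close> by (auto simp: convergent_def)
    qed
    have sub: "(\<lambda>n. \<nu> (r (s n)) x) \<longlonglongrightarrow> 0" if "x \<in> null_vectors \<nu>" for x
      using LIMSEQ_subseq_LIMSEQ[OF _ strict_mono_o[OF r(1) s(1)], of "\<lambda>n. \<nu> n x" 0] that
      by (simp add: null_vectors_def o_def)
    obtain \<rho> where \<rho>: "norm \<rho> \<le> C" "\<And>x. (\<lambda>n. \<nu> (r (s n)) x) \<longlonglongrightarrow> blinfun_apply \<rho> x"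
    proof (rule pointwise_limit_functional[of "\<lambda>n. \<nu> (r (s n))" C "null_vectors \<nu> \<union> H"])
      fix x assume "x \<in> null_vectors \<nu> \<union> H"
      then show "convergent (\<lambda>n. \<nu> (r (s n)) x)"
        using convH sub by (auto simp: convergent_def)
    qed (use C dense in auto)
    have "\<rho> \<in> N"
      using \<rho> sub LIMSEQ_unique by (fastforce simp: N_def)
    have "(\<lambda>n. coord (\<nu> (r (s n)))) \<longlonglongrightarrow> coord \<rho>"
    proof -
      have "l = coord \<rho>"
      proof
        fix k show "l k = coord \<rho> k"
          unfolding coord_def
          by (rule LIMSEQ_unique[OF \<open>(\<lambda>n. \<nu> (r (s n)) (h k)) \<longlonglongrightarrow> l k\<close> \<rho>(2)])
      qed
      then show ?thesis using s(2) by (simp only: o_def)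
    qed
    then have "(\<lambda>n. dist (coord (\<nu> (r (s n)))) (coord \<rho>)) \<longlonglongrightarrow> 0"
      by (rule tendsto_dist_iff[THEN iffD1])
    moreover have "e \<le> dist (coord (\<nu> (r (s n)))) (coord \<rho>)" for n
      using r(2)[of "s n"] infdist_le[of "coord \<rho>" "coord ` N"] \<open>\<rho> \<in> N\<close> by (meson imageI order_trans)
    ultimately have "e \<le> 0"
      by (intro LIMSEQ_le_const) auto
    then show False using \<open>0 < e\<close> by simp
  qed
  have "\<exists>\<rho>\<in>N. dist (coord (\<nu> n)) (coord \<rho>) < infdist (coord (\<nu> n)) (coord ` N) + 1 / Suc n" for n
  proof -
    have "infdist (coord (\<nu> n)) (coord ` N) < infdist (coord (\<nu> n)) (coord ` N) + 1 / Suc n" by simp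
    then show ?thesis
      unfolding infdist_notempty[OF ne]
      by (subst (asm) cINF_less_iff) (use ne in auto)
  qed
  then obtain \<rho> where \<rho>: "\<And>n. \<rho> n \<in> N"
    "\<And>n. dist (coord (\<nu> n)) (coord (\<rho> n)) < infdist (coord (\<nu> n)) (coord ` N) + 1 / Suc n"
    by metis
  show thesis
  proof (rule that[of \<rho>])
    show norm_\<rho>: "norm (\<rho> n) \<le> C" for n
      using \<rho>(1) by (simp add: N_def)
    show vanish: "\<rho> n x = 0" if "x \<in> null_vectors \<nu>" for n x
      using \<rho>(1) that by (simp add: N_def)
    define \<theta> where "\<theta> = (\<lambda>n. \<nu> n - \<rho> n)"
    have "(\<lambda>n. dist (coord (\<theta> n)) (coord 0)) \<longlonglongrightarrow> 0"
    proof (rule tendsto_sandwich[OF _ _ tendsto_const])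
      have "dist (coord (\<nu> n)) (coord (\<rho> n)) = dist (coord (\<theta> n)) (coord 0)" for n
        by (simp add: dist_fun_def coord_def \<theta>_def dist_real_def blinfun.diff_left)
      then show "\<forall>\<^sub>F n in sequentially. dist (coord (\<theta> n)) (coord 0)
          \<le> infdist (coord (\<nu> n)) (coord ` N) + 1 / Suc n"
        using \<rho>(2) by (metis (no_types, lifting) always_eventually less_imp_le)
      show "(\<lambda>n. infdist (coord (\<nu> n)) (coord ` N) + 1 / Suc n) \<longlonglongrightarrow> 0"
        using tendsto_add[OF infdist_null LIMSEQ_Suc[OF lim_1_over_n]] by simp
    qed simp
    then have "(\<lambda>n. coord (\<theta> n)) \<longlonglongrightarrow> coord 0"
      by (rule tendsto_dist_iff[THEN iffD2])
    then have "(\<lambda>n. coord (\<theta> n) k) \<longlonglongrightarrow> coord 0 k" for k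
      by (rule continuous_on_tendsto_compose[OF continuous_on_product_coordinates]) simp_all
    then have "range h \<subseteq> null_vectors \<theta>"
      by (auto simp: null_vectors_def coord_def)
    moreover have "null_vectors \<nu> \<subseteq> null_vectors \<theta>"
      using vanish by (auto simp: null_vectors_def \<theta>_def blinfun.diff_left)
    ultimately have "span (null_vectors \<nu> \<union> H) \<subseteq> null_vectors \<theta>"
      using h by (intro span_minimal subspace_null_vectors) auto
    moreover have "norm (\<theta> n) \<le> C + C" for n
      unfolding \<theta>_def
      using order_trans[OF norm_triangle_ineq4 add_mono[OF C norm_\<rho>]] .
    then have "closed (null_vectors \<theta>)"
      by (rule closed_null_vectors)
    ultimately have "closure (span (null_vectors \<nu> \<union> H)) \<subseteq> null_vectors \<theta>"
      by (rule closure_minimal)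
    then show "null_vectors (\<lambda>n. \<nu> n - \<rho> n) = UNIV"
      using dense by (simp add: \<theta>_def top.extremum_unique)
  qed
qed

section \<open>Continuous functions on the domain of an increasing surjection\<close>

lemma abs_apply_bcontfun_le_norm: "\<bar>apply_bcontfun f x\<bar> \<le> norm f" for f :: "'a::topological_space \<Rightarrow>\<^sub>C real"
  using norm_bounded[of f x] by simp

lemma apply_Bcontfun_compact:
  fixes f :: "'a::topological_space \<Rightarrow> real"
  assumes "compact (UNIV :: 'a set)" "continuous_on UNIV f"
  shows "apply_bcontfun (Bcontfun f) = f"
proof -
  have "bounded (range f)"
    using compact_continuous_image[OF assms(2,1)] by (rule compact_imp_bounded)
  then show ?thesis
    using assms(2) by (intro Bcontfun_inverse) (auto simp: bcontfun_def)
qed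

lemma order_Urysohn:
  fixes a b :: "'a::linorder_topology"
  assumes "compact (UNIV :: 'a set)" "a < b"
  obtains u :: "'a \<Rightarrow>\<^sub>C real" where "\<And>x. 0 \<le> u x" "\<And>x. u x \<le> 1"
    "\<And>x. x \<le> a \<Longrightarrow> u x = 1" "\<And>x. b \<le> x \<Longrightarrow> u x = 0"
proof (rule compact_Urysohn[OF assms(1), of "{b..}" "{..a}" 0 1])
  show "{b..} \<inter> {..a} = {}" using assms(2) by auto
qed (use that in auto)

definition constant_outside :: "'a::linorder \<Rightarrow> 'a \<Rightarrow> ('a \<Rightarrow> real) \<Rightarrow> bool"
  where "constant_outside a b f \<longleftrightarrow> (\<forall>x\<le>a. f x = f a) \<and> (\<forall>x\<ge>b. f x = f b)"

locale compact_line_surjection =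
  fixes \<phi> :: "'k::linorder_topology \<Rightarrow> 'l::linorder_topology"
  assumes compact_K: "compact (UNIV :: 'k set)" and compact_L: "compact (UNIV :: 'l set)"
    and cont: "continuous_on UNIV \<phi>" and mono: "mono \<phi>" and surj: "surj \<phi>"
begin

lemma less_if_image_less: "\<phi> x < \<phi> y \<Longrightarrow> x < y"
  using mono by (metis leD le_less_linear monoD)

definition nonconstant_fibres :: "('k \<Rightarrow> real) \<Rightarrow> 'l set"
  where "nonconstant_fibres f = {t. \<exists>x y. \<phi> x = t \<and> \<phi> y = t \<and> f x \<noteq> f y}"

definition fibre_min :: "'l \<Rightarrow> 'k"
  where "fibre_min t = (LEAST x. \<phi> x = t)"

lemma compact_fibre: "compact (\<phi> -` {t})"
proof -
  have "closed (\<phi> -` {t})"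
    using continuous_on_closed_vimage[of UNIV \<phi>] cont by auto
  then show ?thesis
    using compact_Int_closed[OF compact_K] by simp
qed

lemma fibre_nonempty: "\<phi> -` {t} \<noteq> {}"
  using surj by (metis surj_vimage_empty insert_not_empty)

lemma
  shows image_fibre_min [simp]: "\<phi> (fibre_min t) = t"
    and fibre_min_le: "\<phi> x = t \<Longrightarrow> fibre_min t \<le> x"
proof -
  obtain m where m: "\<phi> m = t" "\<And>x. \<phi> x = t \<Longrightarrow> m \<le> x"
    using compact_attains_inf[OF compact_fibre[of t] fibre_nonempty] by auto
  then have "fibre_min t = m"
    unfolding fibre_min_def by (intro Least_equality) auto
  with m show "\<phi> (fibre_min t) = t" "\<phi> x = t \<Longrightarrow> fibre_min t \<le> x"
    by auto
qed

text \<open>As a continuous map from a compact space, \<open>\<phi>\<close> is closed, hence a quotient map.\<close>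

lemma constant_on_fibres_factors:
  fixes f :: "'k \<Rightarrow>\<^sub>C real"
  assumes "nonconstant_fibres f = {}"
  obtains g :: "'l \<Rightarrow>\<^sub>C real" where "pullback \<phi> g = f"
proof -
  have const: "f x = f y" if "\<phi> x = \<phi> y" for x y
    using assms that unfolding nonconstant_fibres_def by blast
  have f: "f (fibre_min (\<phi> x)) = f x" for x
    by (rule const) simp
  have "continuous_on UNIV (\<lambda>t. f (fibre_min t))"
    unfolding continuous_on_closed_vimage[OF closed_UNIV]
  proof (intro allI impI)
    fix B :: "real set" assume "closed B"
    then have "closed (f -` B)"
      using continuous_on_closed_vimage[of UNIV f] by auto
    then have "compact (f -` B)"
      using compact_Int_closed[OF compact_K] by simp
    then have "closed (\<phi> ` (f -` B))"
      using compact_continuous_image continuous_on_subset[OF cont] compact_imp_closed by blast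
    moreover have "\<phi> ` (f -` B) = (\<lambda>t. f (fibre_min t)) -` B \<inter> UNIV"
    proof (intro equalityI subsetI)
      fix t assume "t \<in> (\<lambda>t. f (fibre_min t)) -` B \<inter> UNIV"
      then show "t \<in> \<phi> ` (f -` B)"
        by (intro image_eqI[of t \<phi> "fibre_min t"]) auto
    qed (auto simp: f)
    ultimately show "closed ((\<lambda>t. f (fibre_min t)) -` B \<inter> UNIV)" by simp
  qed
  then have "apply_bcontfun (Bcontfun (\<lambda>t. f (fibre_min t))) = (\<lambda>t. f (fibre_min t))"
    by (rule apply_Bcontfun_compact[OF compact_L])
  then show thesis
    using f by (intro that[of "Bcontfun (\<lambda>t. f (fibre_min t))"] bcontfun_eqI)
      (simp add: apply_pullback[OF cont])
qed

text \<open>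
  Composing \<open>f\<close> with the retraction of \<open>K\<close> onto a fibre gives a function that is constant outside this
  fibre, and subtracting it makes \<open>f\<close> constant there without disturbing the other fibres. After
  finitely many such steps the remainder factors through \<open>\<phi>\<close>.
\<close>

lemma finite_nonconstant_fibres_in_subspace:
  fixes V :: "('k \<Rightarrow>\<^sub>C real) set" and f :: "'k \<Rightarrow>\<^sub>C real"
  assumes V: "subspace V" and pull: "range (pullback \<phi>) \<subseteq> V"
    and outside: "\<And>a b (f :: 'k \<Rightarrow>\<^sub>C real). \<phi> a = \<phi> b \<Longrightarrow> a \<le> b \<Longrightarrow> constant_outside a b (apply_bcontfun f) \<Longrightarrow> f \<in> V"
    and "finite E" "nonconstant_fibres f \<subseteq> E"
  shows "f \<in> V"
  using \<open>finite E\<close> \<open>nonconstant_fibres f \<subseteq> E\<close>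
proof (induction E arbitrary: f)
  case empty
  then have "nonconstant_fibres f = {}" by simp
  then obtain g where "pullback \<phi> g = f"
    by (rule constant_on_fibres_factors)
  then show ?case
    using pull by auto
next
  case (insert t E)
  obtain b where b: "\<phi> b = t" "\<And>x. \<phi> x = t \<Longrightarrow> x \<le> b"
    using compact_attains_sup[OF compact_fibre[of t] fibre_nonempty] by auto
  define a where "a = fibre_min t"
  have a: "\<phi> a = t" "\<And>x. \<phi> x = t \<Longrightarrow> a \<le> x"
    by (auto simp: a_def fibre_min_le)
  have "a \<le> b" using a b by blast
  define h where "h = Bcontfun (\<lambda>x. f (max a (min b x)))"
  have "continuous_on UNIV (\<lambda>x. f (max a (min b x)))"
    by (rule continuous_on_compose2[OF continuous_on_apply_bcontfun]) (auto intro!: continuous_intros)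
  then have h: "h x = f (max a (min b x))" for x
    unfolding h_def by (simp add: apply_Bcontfun_compact[OF compact_K])
  have "constant_outside a b h"
    using \<open>a \<le> b\<close> by (auto simp: constant_outside_def h min_def max_def)
  then have "h \<in> V"
    using outside \<open>a \<le> b\<close> a(1) b(1) by metis
  moreover have "f - h \<in> V"
  proof (rule insert.IH)
    show "nonconstant_fibres (f - h) \<subseteq> E"
    proof
      fix s assume "s \<in> nonconstant_fibres (f - h)"
      then obtain x y where xy: "\<phi> x = s" "\<phi> y = s" "f x - h x \<noteq> f y - h y"
        by (auto simp: nonconstant_fibres_def)
      consider "s < t" | "s = t" | "s > t" by (rule linorder_cases)
      then have "h x = h y \<and> s \<noteq> t"
      proof cases
        case 1
        then have "x < a" "y < a" using xy a(1) less_if_image_less by auto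
        then show ?thesis using 1 \<open>a \<le> b\<close> by (auto simp: h min_def max_def)
      next
        case 2
        then have "h z = f z" if "\<phi> z = s" for z
          using a(2)[of z] b(2)[of z] that by (auto simp: h min_def max_def)
        then show ?thesis using xy by simp
      next
        case 3
        then have "b < x" "b < y" using xy b(1) less_if_image_less by auto
        then show ?thesis using 3 \<open>a \<le> b\<close> by (auto simp: h min_def max_def)
      qed
      then have "s \<in> nonconstant_fibres f" "s \<noteq> t"
        using xy by (auto simp: nonconstant_fibres_def)
      then show "s \<in> E" using insert.prems by blast
    qed
  qed
  ultimately have "(f - h) + h \<in> V"
    using subspace_add[OF V] by blast
  then show ?case by simp
qed

text \<open>
  Points in different fibres are separated by pullbacks from \<open>L\<close>, and points of the same fibre by a
  function that is constant outside the interval between them.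
\<close>

lemma finite_nonconstant_fibres_ring:
  "function_ring_on {f. continuous_on UNIV f \<and> finite (nonconstant_fibres f)} UNIV"
proof
  fix f g :: "'k \<Rightarrow> real"
  have combine: "nonconstant_fibres (\<lambda>x. p (f x) (g x)) \<subseteq> nonconstant_fibres f \<union> nonconstant_fibres g"
    for p :: "real \<Rightarrow> real \<Rightarrow> real"
  proof
    fix t assume "t \<in> nonconstant_fibres (\<lambda>x. p (f x) (g x))"
    then obtain x y where "\<phi> x = t" "\<phi> y = t" "p (f x) (g x) \<noteq> p (f y) (g y)"
      by (auto simp: nonconstant_fibres_def)
    moreover from this have "f x \<noteq> f y \<or> g x \<noteq> g y" by metis
    ultimately show "t \<in> nonconstant_fibres f \<union> nonconstant_fibres g"
      unfolding nonconstant_fibres_def by blast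
  qed
  assume "f \<in> {f. continuous_on UNIV f \<and> finite (nonconstant_fibres f)}"
    "g \<in> {f. continuous_on UNIV f \<and> finite (nonconstant_fibres f)}"
  then show "(\<lambda>x. f x + g x) \<in> {f. continuous_on UNIV f \<and> finite (nonconstant_fibres f)}"
    "(\<lambda>x. f x * g x) \<in> {f. continuous_on UNIV f \<and> finite (nonconstant_fibres f)}"
    using combine[of "(+)"] combine[of "(*)"]
    by (auto intro!: continuous_intros intro: finite_subset)
next
  fix x y :: 'k assume "x \<noteq> y"
  have *: "\<exists>f\<in>{f. continuous_on UNIV f \<and> finite (nonconstant_fibres f)}. f x \<noteq> f y"
    if "x < y" for x y
  proof (cases "\<phi> x = \<phi> y")
    case True
    obtain u :: "'k \<Rightarrow>\<^sub>C real" where u: "\<And>z. z \<le> x \<Longrightarrow> u z = 1" "\<And>z. z \<ge> y \<Longrightarrow> u z = 0"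
      using order_Urysohn[OF compact_K \<open>x < y\<close>] by metis
    have "nonconstant_fibres u \<subseteq> {\<phi> x}"
    proof
      fix s assume "s \<in> nonconstant_fibres u"
      then obtain v w where vw: "\<phi> v = s" "\<phi> w = s" "u v \<noteq> u w"
        by (auto simp: nonconstant_fibres_def)
      show "s \<in> {\<phi> x}"
      proof (rule ccontr)
        assume "s \<notin> {\<phi> x}"
        then have "(v < x \<and> w < x) \<or> (y < v \<and> y < w)"
          using vw True less_if_image_less by (metis linorder_less_linear singletonI)
        then show False
          using u vw by auto
      qed
    qed
    then have "finite (nonconstant_fibres u)"
      by (rule finite_subset) simp
    moreover have "u x \<noteq> u y" using u(1)[of x] u(2)[of y] by simp
    ultimately show ?thesis by (intro bexI[of _ "apply_bcontfun u"]) auto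
  next
    case False
    obtain g :: "'l \<Rightarrow>\<^sub>C real" where g: "g (\<phi> x) = 0" "g (\<phi> y) = 1"
      by (rule compact_Urysohn[OF compact_L, of "{\<phi> x}" "{\<phi> y}" 0 1]) (use False in auto)
    have "nonconstant_fibres (pullback \<phi> g) = {}"
      by (auto simp: nonconstant_fibres_def apply_pullback[OF cont])
    moreover have "g (\<phi> x) \<noteq> g (\<phi> y)" using g by simp
    ultimately show ?thesis
      by (intro bexI[of _ "apply_bcontfun (pullback \<phi> g)"])
         (auto simp only: apply_pullback[OF cont] continuous_on_apply_bcontfun finite.emptyI mem_Collect_eq)
  qed
  then show "\<exists>f\<in>{f. continuous_on UNIV f \<and> finite (nonconstant_fibres f)}. f x \<noteq> f y"
    using \<open>x \<noteq> y\<close> *[of x y] *[of y x] by (metis linorder_neqE)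
qed (auto simp: compact_K nonconstant_fibres_def)

text \<open>
  The functions that are constant on all but finitely many fibres are dense by the Stone--Weierstrass
  theorem. Passing to them replaces the generators of \<open>V\<close>, which are not closed under products, by an
  algebra that lies in \<open>V\<close>.
\<close>

theorem closed_subspace_eq_UNIV:
  fixes V :: "('k \<Rightarrow>\<^sub>C real) set"
  assumes V: "subspace V" "closed V" and pull: "range (pullback \<phi>) \<subseteq> V"
    and outside: "\<And>a b (f :: 'k \<Rightarrow>\<^sub>C real). \<phi> a = \<phi> b \<Longrightarrow> a \<le> b \<Longrightarrow> constant_outside a b (apply_bcontfun f) \<Longrightarrow> f \<in> V"
  shows "V = UNIV"
proof -
  have "f \<in> closure V" for f
    unfolding closure_approachable
  proof (intro allI impI)
    fix e :: real assume "0 < e"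
    then obtain g where g: "continuous_on UNIV g" "finite (nonconstant_fibres g)" "\<And>x. \<bar>f x - g x\<bar> < e / 2"
      using function_ring_on.Stone_Weierstrass_basic[OF finite_nonconstant_fibres_ring, of f "e / 2"] by auto
    note [simp] = apply_Bcontfun_compact[OF compact_K g(1)]
    have "Bcontfun g \<in> V"
      by (rule finite_nonconstant_fibres_in_subspace[OF V(1) pull outside g(2)]) auto
    moreover have "dist (Bcontfun g) f \<le> e / 2"
      by (rule dist_bound) (use g(3) in \<open>auto simp: dist_real_def abs_minus_commute less_imp_le\<close>)
    ultimately show "\<exists>y\<in>V. dist y f < e"
      using \<open>0 < e\<close> by (intro bexI[of _ "Bcontfun g"]) auto
  qed
  then show ?thesis
    using V(2) by auto
qed

lemma constant_outside_fibre_min: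
  assumes "\<phi> a = \<phi> b" "a \<le> b" "constant_outside a b f"
  shows "f (fibre_min s) = f b + (f a - f b) * indicator {..\<phi> a} s"
proof -
  consider "s < \<phi> a" | "s = \<phi> a" | "s > \<phi> b" using assms(1) by fastforce
  then show ?thesis
  proof cases
    case 1
    then have "fibre_min s < a" by (intro less_if_image_less) simp
    then have "f (fibre_min s) = f a"
      using assms(3) unfolding constant_outside_def by (meson less_imp_le)
    then show ?thesis using 1 by simp
  next
    case 2
    then have "fibre_min s \<le> a" by (intro fibre_min_le) simp
    then have "f (fibre_min s) = f a"
      using assms(3) unfolding constant_outside_def by meson
    then show ?thesis using 2 by simp
  next
    case 3
    then have "b < fibre_min s" by (intro less_if_image_less) simp
    then have "f (fibre_min s) = f b"
      using assms(3) unfolding constant_outside_def by (meson less_imp_le)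
    then show ?thesis using 3 assms(1) by simp
  qed
qed

text \<open>
  The section \<open>fibre_min\<close> is monotone, but the preimage of an open set under it may be an
  uncountable union of intervals, with no reason to be Borel. For the composition with a continuous function, however, measurability only has to be
  checked on the generators of \<open>C(K)\<close>, where the result is continuous or a step function.
\<close>

lemma measurable_fibre_min:
  fixes f :: "'k \<Rightarrow>\<^sub>C real"
  shows "(\<lambda>t. f (fibre_min t)) \<in> borel_measurable borel"
proof -
  let ?V = "{f :: 'k \<Rightarrow>\<^sub>C real. (\<lambda>t. f (fibre_min t)) \<in> borel_measurable borel}"
  have "?V = UNIV"
  proof (rule closed_subspace_eq_UNIV)
    show "subspace ?V"
      by (auto simp: subspace_def)
    show "closed ?V"
      unfolding closed_sequential_limits
    proof (intro allI impI, elim conjE)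
      fix F and f :: "'k \<Rightarrow>\<^sub>C real"
      assume F: "\<forall>n. F n \<in> ?V" "F \<longlonglongrightarrow> f"
      have "(\<lambda>n. F n x) \<longlonglongrightarrow> f x" for x
      proof (rule metric_tendsto_imp_tendsto[OF F(2)])
        show "\<forall>\<^sub>F n in sequentially. dist (F n x) (f x) \<le> dist (F n) f"
          using dist_bounded by (intro always_eventually allI)
      qed
      then show "f \<in> ?V"
        using F(1) borel_measurable_LIMSEQ_real[of borel "\<lambda>n t. F n (fibre_min t)" "\<lambda>t. f (fibre_min t)"]
        by simp
    qed
    show "range (pullback \<phi>) \<subseteq> ?V"
      by (auto simp: apply_pullback[OF cont] intro!: borel_measurable_continuous_onI)
    show "f \<in> ?V" if "\<phi> a = \<phi> b" "a \<le> b" "constant_outside a b (apply_bcontfun f)" for a b f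
      using constant_outside_fibre_min[OF that] by simp
  qed
  then show ?thesis by blast
qed

text \<open>
  Integration against the image of \<open>\<mu>\<close> under the section \<open>fibre_min\<close>. Choosing the minimum of each
  fibre makes the value at a function that jumps from 1 to 0 in the fibre over \<open>t\<close> equal to
  \<open>\<mu> {..t}\<close>; the maximum would give \<open>\<mu> {..<t}\<close>.
\<close>

definition lift_functional :: "('l set \<Rightarrow> real) \<Rightarrow> ('k \<Rightarrow>\<^sub>C real) \<Rightarrow>\<^sub>L real"
  where "lift_functional \<mu> = Blinfun (\<lambda>f :: 'k \<Rightarrow>\<^sub>C real. signed_integral \<mu> (\<lambda>t. f (fibre_min t)))"

context
  fixes \<mu> :: "'l set \<Rightarrow> real"
  assumes \<mu>: "compact_signed_measure \<mu>"
begin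

interpretation compact_signed_measure \<mu> by (rule \<mu>)

lemma lift_functional_bound:
  "\<bar>signed_integral \<mu> (\<lambda>t. apply_bcontfun f (fibre_min t))\<bar> \<le> norm f * tvar UNIV"
  by (rule signed_integral_bound[OF measurable_fibre_min]) (auto simp: abs_apply_bcontfun_le_norm)

lemma lift_functional_apply: "lift_functional \<mu> f = signed_integral \<mu> (\<lambda>t. f (fibre_min t))"
proof -
  have "bounded_linear (\<lambda>f :: 'k \<Rightarrow>\<^sub>C real. signed_integral \<mu> (\<lambda>t. f (fibre_min t)))"
  proof (rule bounded_linear_intro)
    show "signed_integral \<mu> (\<lambda>t. (f + g) (fibre_min t)) =
        signed_integral \<mu> (\<lambda>t. f (fibre_min t)) + signed_integral \<mu> (\<lambda>t. g (fibre_min t))"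
      for f g :: "'k \<Rightarrow>\<^sub>C real"
      by (simp add: signed_integral_add[OF measurable_fibre_min abs_apply_bcontfun_le_norm measurable_fibre_min abs_apply_bcontfun_le_norm])
    show "norm (signed_integral \<mu> (\<lambda>t. f (fibre_min t))) \<le> norm f * tvar UNIV" for f :: "'k \<Rightarrow>\<^sub>C real"
      using lift_functional_bound by simp
  qed (simp add: signed_integral_mult)
  then show ?thesis
    by (simp add: lift_functional_def bounded_linear_Blinfun_apply)
qed

lemma norm_lift_functional:
  assumes "\<And>g :: 'l \<Rightarrow>\<^sub>C real. (\<And>x. \<bar>g x\<bar> \<le> 1) \<Longrightarrow> signed_integral \<mu> g \<le> c"
  shows "norm (lift_functional \<mu>) \<le> c"
proof (rule norm_blinfun_bound)
  have "tvar UNIV \<le> c" using assms by (rule tvar_le)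
  then show "0 \<le> c" using tvar_nonneg[of UNIV] by simp
  show "norm (lift_functional \<mu> f) \<le> c * norm f" for f
    using order_trans[OF lift_functional_bound mult_left_mono[OF \<open>tvar UNIV \<le> c\<close> norm_ge_zero]]
    by (simp add: lift_functional_apply mult.commute)
qed

lemma lift_functional_pullback: "lift_functional \<mu> (pullback \<phi> g) = signed_integral \<mu> g"
  by (simp add: lift_functional_apply apply_pullback[OF cont])

lemma lift_functional_constant_outside:
  assumes "\<phi> a = \<phi> b" "a \<le> b" "constant_outside a b (apply_bcontfun f)"
  shows "lift_functional \<mu> f = f b * \<mu> UNIV + (f a - f b) * \<mu> {..\<phi> a}"
proof -
  have "lift_functional \<mu> f =
      signed_integral \<mu> (\<lambda>s. f b * indicator UNIV s + (f a - f b) * indicator {..\<phi> a} s)"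
    by (simp add: lift_functional_apply constant_outside_fibre_min[OF assms])
  also have "\<dots> = signed_integral \<mu> (\<lambda>s. f b * indicator UNIV s)
      + signed_integral \<mu> (\<lambda>s. (f a - f b) * indicator {..\<phi> a} s)"
    by (rule signed_integral_add[of _ "\<bar>f b\<bar>" _ "\<bar>f a - f b\<bar>"]) (auto simp: abs_mult indicator_def)
  also have "\<dots> = f b * \<mu> UNIV + (f a - f b) * \<mu> {..\<phi> a}"
    by (simp only: signed_integral_mult signed_integral_indicator borel_closed closed_UNIV closed_atMost)
  finally show ?thesis .
qed

end

end

section \<open>Extending a null sequence of measures\<close>

lemma apply_bcontfun_sum: "apply_bcontfun (\<Sum>i\<in>I. f i) x = (\<Sum>i\<in>I. apply_bcontfun (f i) x)"
  for f :: "'i \<Rightarrow> ('a::topological_space \<Rightarrow>\<^sub>C real)"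
  by (induction I rule: infinite_finite_induct) auto

locale null_operator = compact_line_surjection \<phi>
  for \<phi> :: "'k::linorder_topology \<Rightarrow> 'l::linorder_topology" +
  fixes T :: "('l \<Rightarrow>\<^sub>C real) \<Rightarrow>\<^sub>L (nat \<Rightarrow>\<^sub>C real)" and \<mu> :: "nat \<Rightarrow> 'l set \<Rightarrow> real"
  assumes \<mu>_M_space: "\<mu> n \<in> M_space"
    and weak_null: "weak_star_null \<mu>" and associated: "associated_op T \<mu>"
begin

lemma \<mu>_measure: "compact_signed_measure (\<mu> n)"
  by unfold_locales (use compact_L \<mu>_M_space in auto)

sublocale M: compact_signed_measure "\<mu> n" for n
  by (rule \<mu>_measure)

definition bad_points :: "'l set"
  where "bad_points = {t. \<not> (\<lambda>n. \<mu> n {..t}) \<longlonglongrightarrow> 0}"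

lemma T_apply: "apply_bcontfun (T g) n = signed_integral (\<mu> n) g"
  using associated by (simp add: associated_op_def)

text \<open>The indicator of a clopen set is an admissible test function for weak* convergence.\<close>

lemma clopen_null:
  assumes "closed C" "open C"
  shows "(\<lambda>n. \<mu> n C) \<longlonglongrightarrow> 0"
proof -
  obtain g :: "'l \<Rightarrow>\<^sub>C real" where g: "\<And>x. x \<in> -C \<Longrightarrow> g x = 0" "\<And>x. x \<in> C \<Longrightarrow> g x = 1"
    by (rule compact_Urysohn[OF compact_L, of "-C" C 0 1]) (use assms in auto)
  then have "apply_bcontfun g = indicator C"
    by (auto simp: fun_eq_iff indicator_def)
  then have "signed_integral (\<mu> n) g = \<mu> n C" for n
    using assms by (simp add: M.signed_integral_indicator)
  then show ?thesis
    using weak_null[unfolded weak_star_null_def, rule_format, of g] by simp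
qed

text \<open>
  If \<open>t\<close> were not the minimum, it would be the maximum, or have an immediate successor or predecessor. Then \<open>{..t}\<close>
  is clopen, or becomes clopen after removing the point \<open>t\<close>, which carries no mass.
\<close>

lemma bad_not_internal:
  assumes t: "t \<in> bad_points" "\<not> internal_point t" and atom: "\<And>n. \<mu> n {t} = 0"
  shows "t \<le> y"
proof (rule ccontr)
  assume "\<not> t \<le> y"
  then consider (max) "\<forall>z. z \<le> t" | (succ) z where "z > t" "{t<..<z} = {}"
    | (pred) z where "z < t" "{z<..<t} = {}"
    using t(2) unfolding internal_point_def by blast
  then have "(\<lambda>n. \<mu> n {..t}) \<longlonglongrightarrow> 0"
  proof cases
    case max
    then have "{..t} = UNIV" by auto
    then show ?thesis using clopen_null[of UNIV] by simp
  next
    case succ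
    then have "{..t} = {..<z}" by (auto simp: not_less[symmetric])
    then show ?thesis using clopen_null[of "{..t}"] by (metis closed_atMost open_lessThan)
  next
    case pred
    then have "{..<t} = {..z}" by (auto simp: not_less[symmetric])
    then have "(\<lambda>n. \<mu> n {..<t}) \<longlonglongrightarrow> 0"
      using clopen_null[of "{..<t}"] by (metis closed_atMost open_lessThan)
    moreover have "{..<t} \<union> {t} = {..t}" by auto
    then have "\<mu> n {..t} = \<mu> n {..<t}" for n
      using signed_borel_measure_Un[OF M.signed[of n], of "{..<t}" "{t}"] atom[of n]
      by simp
    ultimately show ?thesis by simp
  qed
  then show False using t(1) by (simp add: bad_points_def)
qed

lemma countable_bad_iff_internal:
  "countable (Q \<phi> \<inter> bad_points) \<longleftrightarrow> countable (Q0 \<phi> \<inter> bad_points)"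
proof
  assume "countable (Q \<phi> \<inter> bad_points)"
  then show "countable (Q0 \<phi> \<inter> bad_points)"
    by (rule countable_subset[rotated]) (auto simp: Q0_def)
next
  assume "countable (Q0 \<phi> \<inter> bad_points)"
  moreover have "countable (\<Union>n. {t. \<mu> n {t} \<noteq> 0})"
    by (intro countable_UN M.countable_atoms) simp
  moreover have "countable {t :: 'l. \<forall>y. t \<le> y}"
  proof -
    have "{t :: 'l. \<forall>y. t \<le> y} \<subseteq> {LEAST t. True}"
      by (auto intro!: Least_equality[symmetric])
    then show ?thesis by (rule countable_subset) simp
  qed
  moreover have "Q \<phi> \<inter> bad_points \<subseteq>
      (Q0 \<phi> \<inter> bad_points) \<union> (\<Union>n. {t. \<mu> n {t} \<noteq> 0}) \<union> {t. \<forall>y. t \<le> y}"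
    using bad_not_internal by (auto simp: Q0_def)
  ultimately show "countable (Q \<phi> \<inter> bad_points)"
    by (meson countable_Un countable_subset)
qed

lemma splitting_function:
  assumes "t \<in> Q \<phi>"
  obtains a b and u :: "'k \<Rightarrow>\<^sub>C real" where "\<phi> a = t" "\<phi> b = t" "a < b"
    "\<And>x. 0 \<le> u x" "\<And>x. u x \<le> 1" "\<And>x. x \<le> a \<Longrightarrow> u x = 1" "\<And>x. b \<le> x \<Longrightarrow> u x = 0"
proof -
  obtain a b where "\<phi> a = t" "\<phi> b = t" "a < b"
    using assms unfolding Q_def by (auto elim!: linorder_neqE)
  then show thesis
    using order_Urysohn[OF compact_K \<open>a < b\<close>] that by metis
qed

text \<open>
  The functionals \<open>lift_functional (\<mu> n)\<close> extend the coordinates of \<open>T\<close> with norm at most \<open>norm T\<close>, and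
  the functions at which they do not tend to 0 come from the countably many bad fibres, each of
  which contributes one dimension modulo the null vectors. This is the situation of
  \<open>Sobczyk_correction\<close>, whose correction terms have norm at most \<open>norm T\<close> again.
\<close>

theorem extension_if_countable:
  assumes "countable (Q \<phi> \<inter> bad_points)"
  obtains T' :: "('k \<Rightarrow>\<^sub>C real) \<Rightarrow>\<^sub>L (nat \<Rightarrow>\<^sub>C real)" where "range (blinfun_apply T') \<subseteq> c0"
    "blinfun_apply T' \<circ> pullback \<phi> = blinfun_apply T" "norm T' \<le> 2 * norm T"
proof -
  define \<nu> where "\<nu> = (\<lambda>n. lift_functional (\<mu> n))"
  have norm_\<nu>: "norm (\<nu> n) \<le> norm T" for n
    unfolding \<nu>_def
  proof (rule norm_lift_functional[OF \<mu>_measure])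
    fix g :: "'l \<Rightarrow>\<^sub>C real" assume "\<And>x. \<bar>g x\<bar> \<le> 1"
    then have "norm g \<le> 1" by (intro norm_bound) simp
    have "signed_integral (\<mu> n) g \<le> norm (T g)"
      using abs_apply_bcontfun_le_norm[of "T g" n] by (simp add: T_apply)
    also have "\<dots> \<le> norm T * norm g" by (rule norm_blinfun)
    also have "\<dots> \<le> norm T" using \<open>norm g \<le> 1\<close> by (simp add: mult_left_le)
    finally show "signed_integral (\<mu> n) g \<le> norm T" .
  qed
  have pull: "pullback \<phi> g \<in> null_vectors \<nu>" for g
    using weak_null by (simp add: null_vectors_def \<nu>_def lift_functional_pullback[OF \<mu>_measure] weak_star_null_def)
  have total: "(\<lambda>n. \<mu> n UNIV) \<longlonglongrightarrow> 0"
    using clopen_null[of UNIV] by simp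
  have "\<exists>u :: 'k \<Rightarrow>\<^sub>C real. \<exists>a b. \<phi> a = t \<and> \<phi> b = t \<and> a \<le> b \<and> constant_outside a b u \<and> u a = 1 \<and> u b = 0"
    if "t \<in> Q \<phi>" for t
  proof -
    obtain a b and u :: "'k \<Rightarrow>\<^sub>C real" where "\<phi> a = t" "\<phi> b = t" "a < b"
      "\<And>x. x \<le> a \<Longrightarrow> u x = 1" "\<And>x. b \<le> x \<Longrightarrow> u x = 0"
      using splitting_function[OF \<open>t \<in> Q \<phi>\<close>] by metis
    then show ?thesis
      by (intro exI[of _ u] exI[of _ a] exI[of _ b]) (auto simp: constant_outside_def)
  qed
  then obtain u :: "'l \<Rightarrow> ('k \<Rightarrow>\<^sub>C real)" where u: "\<And>t. t \<in> Q \<phi> \<Longrightarrow>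
      \<exists>a b. \<phi> a = t \<and> \<phi> b = t \<and> a \<le> b \<and> constant_outside a b (u t) \<and> u t a = 1 \<and> u t b = 0"
    by metis
  have \<nu>_u: "\<nu> n (u t) = \<mu> n {..t}" if "t \<in> Q \<phi>" for t n
  proof -
    obtain a b where "\<phi> a = t" "\<phi> b = t" "a \<le> b" "constant_outside a b (u t)" "u t a = 1" "u t b = 0"
      using u \<open>t \<in> Q \<phi>\<close> by metis
    then show ?thesis
      using lift_functional_constant_outside[OF \<mu>_measure, of a b "u t" n] by (simp add: \<nu>_def)
  qed
  define H where "H = u ` (Q \<phi> \<inter> bad_points)"
  define V where "V = closure (span (null_vectors \<nu> \<union> H))"
  have base: "null_vectors \<nu> \<union> H \<subseteq> V"
    unfolding V_def using span_superset closure_subset by (rule order_trans)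
  have "V = UNIV"
  proof (rule closed_subspace_eq_UNIV)
    show V: "subspace V" unfolding V_def by (rule subspace_closure) (rule subspace_span)
    show "closed V" by (simp add: V_def)
    show "range (pullback \<phi>) \<subseteq> V" using pull base by auto
    fix a b and f :: "'k \<Rightarrow>\<^sub>C real"
    assume f: "\<phi> a = \<phi> b" "a \<le> b" "constant_outside a b f"
    define t where "t = \<phi> a"
    have \<nu>_f: "\<nu> n f = f b * \<mu> n UNIV + (f a - f b) * \<mu> n {..t}" for n
      using lift_functional_constant_outside[OF \<mu>_measure f] by (simp add: \<nu>_def t_def)
    consider (bad) "t \<in> Q \<phi> \<inter> bad_points" | (good) "t \<notin> bad_points" | (single) "t \<notin> Q \<phi>" by blast
    then show "f \<in> V"
    proof cases
      case bad
      \<comment> \<open>Subtracting the jump of \<open>f\<close> across the fibre leaves only a multiple of \<open>\<mu> n UNIV\<close>.\<close>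
      define g where "g = f - (f a - f b) *\<^sub>R u t"
      have "\<nu> n g = f b * \<mu> n UNIV" for n
        using bad by (simp add: g_def blinfun.diff_right blinfun.scaleR_right \<nu>_f \<nu>_u)
      then have "g \<in> null_vectors \<nu>"
        unfolding null_vectors_def using tendsto_mult_right_zero[OF total] by simp
      then have "g \<in> V" using base by blast
      moreover have "u t \<in> V" using base bad by (auto simp: H_def)
      ultimately have "g + (f a - f b) *\<^sub>R u t \<in> V"
        using V by (simp add: subspace_add subspace_scale)
      then show ?thesis by (simp add: g_def)
    next
      case good
      then have "(\<lambda>n. \<mu> n {..t}) \<longlonglongrightarrow> 0" by (simp add: bad_points_def)
      then have "(\<lambda>n. \<nu> n f) \<longlonglongrightarrow> 0"
        unfolding \<nu>_f using tendsto_add[OF tendsto_mult_right_zero[OF total] tendsto_mult_right_zero] by fastforce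
      then show ?thesis using base by (auto simp: null_vectors_def)
    next
      case single
      then have "a = b" using f(1) by (auto simp: Q_def t_def)
      then have "(\<lambda>n. \<nu> n f) \<longlonglongrightarrow> 0"
        unfolding \<nu>_f using tendsto_mult_right_zero[OF total] by simp
      then show ?thesis using base by (auto simp: null_vectors_def)
    qed
  qed
  have "countable H" unfolding H_def using assms by simp
  obtain \<rho> where \<rho>: "\<And>n. norm (\<rho> n) \<le> norm T"
      "\<And>n x. x \<in> null_vectors \<nu> \<Longrightarrow> blinfun_apply (\<rho> n) x = 0" "null_vectors (\<lambda>n. \<nu> n - \<rho> n) = UNIV"
    by (rule Sobczyk_correction[OF norm_\<nu> \<open>countable H\<close> \<open>V = UNIV\<close>[unfolded V_def]]) blast
  define \<theta> where "\<theta> = (\<lambda>n. \<nu> n - \<rho> n)"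
  have "norm (\<theta> n) \<le> 2 * norm T" for n
    unfolding \<theta>_def using norm_triangle_ineq4[of "\<nu> n" "\<rho> n"] norm_\<nu>[of n] \<rho>(1)[of n] by linarith
  then have \<theta>_bound: "\<bar>\<theta> n f\<bar> \<le> 2 * norm T * norm f" for n f
    by (rule blinfun_bound_by)
  define S where "S = (\<lambda>f. Bcontfun (\<lambda>n. \<theta> n f))"
  have S: "apply_bcontfun (S f) n = \<theta> n f" for f n
  proof -
    have "(\<lambda>n. \<theta> n f) \<in> bcontfun"
      by (rule bcontfun_normI[of _ "2 * norm T * norm f"]) (use \<theta>_bound in auto)
    then show ?thesis by (simp add: S_def Bcontfun_inverse)
  qed
  have S_bound: "norm (S f) \<le> 2 * norm T * norm f" for f
    by (rule norm_bound) (use \<theta>_bound in \<open>simp add: S\<close>)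
  have "bounded_linear S"
  proof (rule bounded_linear_intro)
    show "S (f + g) = S f + S g" for f g
      by (rule bcontfun_eqI) (simp add: S blinfun.add_right)
    show "S (r *\<^sub>R f) = r *\<^sub>R S f" for r f
      by (rule bcontfun_eqI) (simp add: S blinfun.scaleR_right)
    show "norm (S f) \<le> norm f * (2 * norm T)" for f
      using S_bound[of f] by (simp add: mult.commute)
  qed
  then have Blinfun_S: "blinfun_apply (Blinfun S) = S"
    by (rule bounded_linear_Blinfun_apply)
  show thesis
  proof (rule that[of "Blinfun S"])
    show "range (blinfun_apply (Blinfun S)) \<subseteq> c0"
    proof
      fix y assume "y \<in> range (blinfun_apply (Blinfun S))"
      then obtain f where "y = S f" by (auto simp: Blinfun_S)
      moreover have "f \<in> null_vectors \<theta>" using \<rho>(3) by (simp add: \<theta>_def)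
      moreover have "apply_bcontfun (S f) = (\<lambda>n. \<theta> n f)"
        by (rule ext) (rule S)
      ultimately show "y \<in> c0" by (simp add: c0_def null_vectors_def)
    qed
    show "blinfun_apply (Blinfun S) \<circ> pullback \<phi> = blinfun_apply T"
    proof
      fix g
      have "S (pullback \<phi> g) = T g"
        by (rule bcontfun_eqI)
           (simp add: S \<theta>_def blinfun.diff_left \<rho>(2)[OF pull] \<nu>_def lift_functional_pullback[OF \<mu>_measure] T_apply)
      then show "(blinfun_apply (Blinfun S) \<circ> pullback \<phi>) g = blinfun_apply T g"
        by (simp add: Blinfun_S)
    qed
    show "norm (Blinfun S) \<le> 2 * norm T"
      by (rule norm_blinfun_bound) (use S_bound in \<open>auto simp: Blinfun_S\<close>)
  qed
qed

text \<open>
  Boundedness of the \<open>n\<close>-th coordinate of \<open>T'\<close> forces its value at \<open>u\<^sub>t\<close> to agree with \<open>\<mu> n {..t}\<close> up to \<open>e\<close>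
  for all but finitely many \<open>t\<close> (\<open>finite_gap\<close>), whatever the choice of \<open>u\<^sub>t\<close> and of the extension.
\<close>

theorem countable_if_extension:
  fixes T' :: "('k \<Rightarrow>\<^sub>C real) \<Rightarrow>\<^sub>L (nat \<Rightarrow>\<^sub>C real)"
  assumes range: "range (blinfun_apply T') \<subseteq> c0"
    and extends: "blinfun_apply T' \<circ> pullback \<phi> = blinfun_apply T"
  shows "countable (Q \<phi> \<inter> bad_points)"
proof -
  have "\<exists>u :: 'k \<Rightarrow>\<^sub>C real. \<exists>a b. \<phi> a = t \<and> \<phi> b = t \<and> (\<forall>x. 0 \<le> u x \<and> u x \<le> 1)
      \<and> (\<forall>x\<le>a. u x = 1) \<and> (\<forall>x\<ge>b. u x = 0)"
    if "t \<in> Q \<phi>" for t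
    by (rule splitting_function[OF that]) blast
  then obtain u :: "'l \<Rightarrow> ('k \<Rightarrow>\<^sub>C real)" where u: "\<And>t. t \<in> Q \<phi> \<Longrightarrow>
      \<exists>a b. \<phi> a = t \<and> \<phi> b = t \<and> (\<forall>x. 0 \<le> u t x \<and> u t x \<le> 1)
      \<and> (\<forall>x\<le>a. u t x = 1) \<and> (\<forall>x\<ge>b. u t x = 0)"
    by metis
  have u_less: "u t x = 1" if "t \<in> Q \<phi>" "\<phi> x < t" for t x
  proof -
    obtain a where "\<phi> a = t" "\<forall>x\<le>a. u t x = 1"
      using u[OF \<open>t \<in> Q \<phi>\<close>] by blast
    then show ?thesis
      using less_if_image_less[of x a] that(2) by simp
  qed
  have u_greater: "u t x = 0" if "t \<in> Q \<phi>" "t < \<phi> x" for t x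
  proof -
    obtain b where "\<phi> b = t" "\<forall>x\<ge>b. u t x = 0"
      using u[OF \<open>t \<in> Q \<phi>\<close>] by blast
    then show ?thesis
      using less_if_image_less[of b x] that(2) by simp
  qed
  have u_bounds: "0 \<le> u t x" "u t x \<le> 1" if "t \<in> Q \<phi>" for t x
    using u[OF that] by auto
  have finite_gap: "finite {t \<in> Q \<phi>. e \<le> \<bar>T' (u t) n - \<mu> n {..t}\<bar>}" (is "finite ?G")
    if "0 < e" for e n
  proof (rule ccontr)
    assume "infinite ?G"
    obtain m :: nat where m: "norm T' < m * (e / 2)"
      using reals_Archimedean3[of "e / 2"] \<open>0 < e\<close> by auto
    obtain D where D: "finite D" "card D = m" "D \<subseteq> ?G"
      using infinite_arbitrarily_large[OF \<open>infinite ?G\<close>, of m] by (elim exE conjE)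
    \<comment> \<open>\<open>g t\<close> approximates the indicator of \<open>{..t}\<close> and vanishes from the next point of \<open>D\<close> on, so that the
      functions \<open>w t\<close> below have disjoint supports.\<close>
    have "\<exists>g :: 'l \<Rightarrow>\<^sub>C real. (\<forall>x. 0 \<le> g x \<and> g x \<le> 1) \<and> (\<forall>x\<le>t. g x = 1)
        \<and> (\<forall>d\<in>D. t < d \<longrightarrow> (\<forall>x\<ge>d. g x = 0)) \<and> \<bar>signed_integral (\<mu> n) g - \<mu> n {..t}\<bar> < e / 2" for t
    proof -
      let ?Z = "\<Union>d\<in>{d \<in> D. t < d}. {d..}"
      have "closed ?Z" using D(1) by (intro closed_UN) auto
      moreover have "{..t} \<inter> ?Z = {}" by auto
      moreover have "0 < e / 2" using \<open>0 < e\<close> by simp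
      ultimately obtain g :: "'l \<Rightarrow>\<^sub>C real" where "\<And>x. 0 \<le> g x" "\<And>x. g x \<le> 1"
          "\<And>x. x \<in> {..t} \<Longrightarrow> g x = 1" "\<And>x. x \<in> ?Z \<Longrightarrow> g x = 0"
          "\<bar>signed_integral (\<mu> n) g - \<mu> n {..t}\<bar> < e / 2"
        by (rule M.cutoff_approximation[OF closed_atMost]) blast
      then show ?thesis
        by (intro exI[of _ g]) blast
    qed
    then obtain g :: "'l \<Rightarrow> ('l \<Rightarrow>\<^sub>C real)" where
      g_bounds: "\<And>t x. 0 \<le> g t x" "\<And>t x. g t x \<le> 1" and g_le: "\<And>t x. x \<le> t \<Longrightarrow> g t x = 1"
      and g_ge: "\<And>t d x. d \<in> D \<Longrightarrow> t < d \<Longrightarrow> d \<le> x \<Longrightarrow> g t x = 0"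
      and g_close: "\<And>t. \<bar>signed_integral (\<mu> n) (g t) - \<mu> n {..t}\<bar> < e / 2"
      by metis
    define w where "w = (\<lambda>t. u t - pullback \<phi> (g t))"
    have w: "w t x = u t x - g t (\<phi> x)" for t x
      by (simp add: w_def apply_pullback[OF cont])
    have w_bound: "\<bar>w t x\<bar> \<le> 1" if "t \<in> D" for t x
      using u_bounds[of t x] g_bounds[of t "\<phi> x"] D(3) that by (auto simp: w)
    have w_support: "t \<le> \<phi> x" "\<And>d. d \<in> D \<Longrightarrow> t < d \<Longrightarrow> \<phi> x < d" if "t \<in> D" "w t x \<noteq> 0" for t x
    proof -
      have "t \<in> Q \<phi>" using D(3) \<open>t \<in> D\<close> by blast
      show "t \<le> \<phi> x"
        using u_less[OF \<open>t \<in> Q \<phi>\<close>] g_le[of "\<phi> x" t] \<open>w t x \<noteq> 0\<close> by (force simp: w)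
      show "\<phi> x < d" if "d \<in> D" "t < d" for d
        using u_greater[OF \<open>t \<in> Q \<phi>\<close>, of x] g_ge[OF that, of "\<phi> x"] \<open>w t x \<noteq> 0\<close> \<open>t < d\<close>
        by (force simp: w not_le[symmetric])
    qed
    define c where "c = (\<lambda>t. sgn (T' (w t) n))"
    define f where "f = (\<Sum>t\<in>D. c t *\<^sub>R w t)"
    have "norm f \<le> 1"
    proof (rule norm_bound)
      fix x
      have fx: "f x = (\<Sum>t\<in>D. c t * w t x)"
        by (simp add: f_def apply_bcontfun_sum)
      show "norm (f x) \<le> 1"
      proof (cases "\<exists>t\<in>D. w t x \<noteq> 0")
        case True
        then obtain t where t: "t \<in> D" "w t x \<noteq> 0" by blast
        have "w s x = 0" if "s \<in> D" "s \<noteq> t" for s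
        proof (rule ccontr)
          assume "w s x \<noteq> 0"
          then show False
            using w_support[OF t] w_support[of s x] t that by (metis leD linorder_neqE)
        qed
        then have "f x = (\<Sum>s\<in>{t}. c s * w s x)"
          unfolding fx using t D(1) by (intro sum.mono_neutral_right) auto
        moreover have "\<bar>c t\<bar> \<le> 1" by (simp add: c_def abs_sgn_eq)
        ultimately show ?thesis
          using w_bound[OF t(1), of x] by (simp add: abs_mult mult_le_one)
      qed (simp add: fx)
    qed
    have "e / 2 \<le> c t * T' (w t) n" if "t \<in> D" for t
    proof -
      have "T' (pullback \<phi> (g t)) = T (g t)"
        using extends by (metis comp_apply)
      then have "T' (w t) n = T' (u t) n - signed_integral (\<mu> n) (g t)"
        by (simp add: w_def blinfun.diff_right T_apply)
      moreover have "e \<le> \<bar>T' (u t) n - \<mu> n {..t}\<bar>" using D(3) that by blast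
      ultimately have "e / 2 \<le> \<bar>T' (w t) n\<bar>" using g_close[of t] by linarith
      then show ?thesis by (simp add: c_def abs_sgn mult.commute)
    qed
    then have "real m * (e / 2) \<le> (\<Sum>t\<in>D. c t * T' (w t) n)"
      using sum_bounded_below[of D "e / 2" "\<lambda>t. c t * T' (w t) n"] D(2) by simp
    also have "\<dots> = T' f n"
      by (simp add: f_def blinfun.sum_right blinfun.scaleR_right apply_bcontfun_sum)
    also have "\<dots> \<le> norm (T' f)"
      using abs_apply_bcontfun_le_norm[of "T' f" n] by simp
    also have "\<dots> \<le> norm T' * norm f" by (rule norm_blinfun)
    also have "\<dots> \<le> norm T'" using \<open>norm f \<le> 1\<close> by (simp add: mult_left_le)
    finally show False using m by simp
  qed
  have "countable (\<Union>n. \<Union>k. {t \<in> Q \<phi>. 1 / real (Suc k) \<le> \<bar>T' (u t) n - \<mu> n {..t}\<bar>})"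
    by (intro countable_UN countableI_type countable_finite finite_gap) simp
  moreover have "Q \<phi> \<inter> bad_points \<subseteq> (\<Union>n. \<Union>k. {t \<in> Q \<phi>. 1 / real (Suc k) \<le> \<bar>T' (u t) n - \<mu> n {..t}\<bar>})"
  proof (rule subsetI, rule ccontr)
    fix t assume t: "t \<in> Q \<phi> \<inter> bad_points"
      and "t \<notin> (\<Union>n. \<Union>k. {t \<in> Q \<phi>. 1 / real (Suc k) \<le> \<bar>T' (u t) n - \<mu> n {..t}\<bar>})"
    then have small: "\<bar>T' (u t) n - \<mu> n {..t}\<bar> < 1 / real (Suc k)" for n k
      by (auto simp: not_le[symmetric])
    have "apply_bcontfun (T' (u t)) = (\<lambda>n. \<mu> n {..t})"
    proof (rule ext, rule ccontr)
      fix n assume "T' (u t) n \<noteq> \<mu> n {..t}"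
      then obtain k where "1 / real (Suc k) < \<bar>T' (u t) n - \<mu> n {..t}\<bar>"
        using nat_approx_posE[of "\<bar>T' (u t) n - \<mu> n {..t}\<bar>"] by auto
      then show False using small[of n k] by simp
    qed
    moreover have "apply_bcontfun (T' (u t)) \<longlonglongrightarrow> 0"
      using range by (auto simp: c0_def)
    ultimately have "(\<lambda>n. \<mu> n {..t}) \<longlonglongrightarrow> 0" by simp
    then show False using t by (simp add: bad_points_def)
  qed
  ultimately show ?thesis by (rule countable_subset[rotated])
qed

end

theorem proposition2p5:
  fixes \<phi> :: "'k::linorder_topology \<Rightarrow> 'l::linorder_topology"
    and T :: "('l \<Rightarrow>\<^sub>C real) \<Rightarrow>\<^sub>L (nat \<Rightarrow>\<^sub>C real)"
    and F :: "nat \<Rightarrow> 'l \<Rightarrow> real"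
    and \<mu> :: "nat \<Rightarrow> 'l set \<Rightarrow> real"
  assumes "compact (UNIV :: 'k set)" and "compact (UNIV :: 'l set)"
    and "continuous_on UNIV \<phi>" and "mono \<phi>" and "surj \<phi>"
    and "\<And>n. F n \<in> NBV"
    and "\<And>n. \<mu> n \<in> M_space" and "\<And>n. distr_fun (\<mu> n) = F n"
    and "weak_star_null \<mu>"
    and "range (blinfun_apply T) \<subseteq> c0"
    and "associated_op T \<mu>"
  shows "((\<exists>T' :: ('k \<Rightarrow>\<^sub>C real) \<Rightarrow>\<^sub>L (nat \<Rightarrow>\<^sub>C real).
            range (blinfun_apply T') \<subseteq> c0 \<and> blinfun_apply T' \<circ> pullback \<phi> = blinfun_apply T)
          \<longleftrightarrow> countable {t \<in> Q \<phi>. \<not> (\<lambda>n. F n t) \<longlonglongrightarrow> 0})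
       \<and> (countable {t \<in> Q \<phi>. \<not> (\<lambda>n. F n t) \<longlonglongrightarrow> 0}
          \<longleftrightarrow> countable {t \<in> Q0 \<phi>. \<not> (\<lambda>n. F n t) \<longlonglongrightarrow> 0})
       \<and> (countable {t \<in> Q0 \<phi>. \<not> (\<lambda>n. F n t) \<longlonglongrightarrow> 0}
          \<longleftrightarrow> (\<exists>T' :: ('k \<Rightarrow>\<^sub>C real) \<Rightarrow>\<^sub>L (nat \<Rightarrow>\<^sub>C real).
            range (blinfun_apply T') \<subseteq> c0 \<and> blinfun_apply T' \<circ> pullback \<phi> = blinfun_apply T \<and>
            norm T' \<le> 2 * norm T))"
proof -
  interpret null_operator \<phi> T \<mu>
    by unfold_locales (use assms in auto)
  have "F n t = \<mu> n {..t}" for n t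
    using assms(8)[of n] by (simp add: distr_fun_def fun_eq_iff)
  then have sets: "{t \<in> Q \<phi>. \<not> (\<lambda>n. F n t) \<longlonglongrightarrow> 0} = Q \<phi> \<inter> bad_points"
    "{t \<in> Q0 \<phi>. \<not> (\<lambda>n. F n t) \<longlonglongrightarrow> 0} = Q0 \<phi> \<inter> bad_points"
    by (auto simp: bad_points_def)
  have sufficient: "\<exists>T' :: ('k \<Rightarrow>\<^sub>C real) \<Rightarrow>\<^sub>L (nat \<Rightarrow>\<^sub>C real).
      range (blinfun_apply T') \<subseteq> c0 \<and> blinfun_apply T' \<circ> pullback \<phi> = blinfun_apply T \<and>
      norm T' \<le> 2 * norm T" if "countable (Q \<phi> \<inter> bad_points)"
    by (rule extension_if_countable[OF that]) (intro exI conjI)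
  show ?thesis
    unfolding sets countable_bad_iff_internal[symmetric]
  proof (intro conjI iffI)
    show "countable (Q \<phi> \<inter> bad_points)"
      if "\<exists>T' :: ('k \<Rightarrow>\<^sub>C real) \<Rightarrow>\<^sub>L (nat \<Rightarrow>\<^sub>C real).
        range (blinfun_apply T') \<subseteq> c0 \<and> blinfun_apply T' \<circ> pullback \<phi> = blinfun_apply T"
      using that by (elim exE conjE) (rule countable_if_extension)
    show "countable (Q \<phi> \<inter> bad_points)"
      if "\<exists>T' :: ('k \<Rightarrow>\<^sub>C real) \<Rightarrow>\<^sub>L (nat \<Rightarrow>\<^sub>C real).
        range (blinfun_apply T') \<subseteq> c0 \<and> blinfun_apply T' \<circ> pullback \<phi> = blinfun_apply T \<and>
        norm T' \<le> 2 * norm T"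
      using that by (elim exE conjE) (rule countable_if_extension)
    show "\<exists>T' :: ('k \<Rightarrow>\<^sub>C real) \<Rightarrow>\<^sub>L (nat \<Rightarrow>\<^sub>C real).
        range (blinfun_apply T') \<subseteq> c0 \<and> blinfun_apply T' \<circ> pullback \<phi> = blinfun_apply T"
      if "countable (Q \<phi> \<inter> bad_points)"
      using sufficient[OF that] by (elim exE conjE) (intro exI conjI)
  qed (assumption | rule sufficient)+
qed

end
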